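(* Let $m \geq n$ and let $F : \mathbb{C}^n \to \mathbb{C}^n$ be a polynomial map such that for a fixed $\mu \in \mathbb{C}$ we have $$\det\Big(\sum_{i=1}^m (\mathcal{J}F)|_{X=\alpha_i}\Big) = \mu$$ for all $\alpha_1, \alpha_2, \ldots, \alpha_m \in \mathbb{C}^n$. Then $\mu = \det(m\,\mathcal{J}F) = m^n \det(\mathcal{J}F)$, and for all $s \in \mathbb{N}$ $$\det\Big(\sum_{i=1}^s b_i \cdot (\mathcal{J}F)|_{X=\alpha_i}\Big) = \Big(\frac{1}{m}\sum_{i=1}^s b_i\Big)^n \mu = \Big(\sum_{i=1}^s b_i\Big)^n \det(\mathcal{J}F)$$ for all $\alpha_1, \alpha_2, \ldots, \alpha_s \in \mathbb{C}^n$ and all $b_1, b_2, \ldots, b_s \in \mathbb{C}$. Furthermore, $F$ is an invertible polynomial map in case $\det \mathcal{J}F \neq 0$.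
   Context: Here $n\ge 1$ and $m$ are integers. $\mathcal{J}F$ denotes the Jacobian matrix of $F$ with respect to the coordinates $X=(X_1,\ldots,X_n)$ (an $n\times n$ matrix of polynomials), and $(\mathcal{J}F)|_{X=\alpha}$ is its evaluation at $\alpha \in \mathbb{C}^n$. Equalities involving $\det(\mathcal{J}F)$ are equalities of polynomials in $\mathbb{C}[X_1,\ldots,X_n]$ (so in particular $\det(\mathcal{J}F)$ is a constant). A polynomial map $\mathbb{C}^n\to\mathbb{C}^n$ is invertible if it has an inverse that is a polynomial map. *)

theory Defs
  imports "HOL-Analysis.Analysis" "HOL-Library.Poly_Mapping"
begin

text \<open>
  Polynomials in the variables \<open>X\<^sub>i\<close>, \<open>i :: 'n\<close>, are finitely supported maps from exponent vectors
  to coefficients; the ring operations are the convolution ones of \<^theory>\<open>HOL-Library.Poly_Mapping\<close>,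
  so \<^const>\<open>det\<close> also applies to matrices of polynomials.
\<close>

type_synonym ('n, 'a) mpoly = "('n \<Rightarrow>\<^sub>0 nat) \<Rightarrow>\<^sub>0 'a"

definition mpoly_const :: "'a::zero \<Rightarrow> ('n, 'a) mpoly" where
  "mpoly_const c = Poly_Mapping.single 0 c"

definition mpoly_eval :: "('n::finite, 'a::comm_semiring_1) mpoly \<Rightarrow> 'a ^ 'n \<Rightarrow> 'a" where
  "mpoly_eval p x =
     (\<Sum>e\<in>Poly_Mapping.keys p.
        Poly_Mapping.lookup p e * (\<Prod>i\<in>UNIV. x $ i ^ Poly_Mapping.lookup e i))"

text \<open>
  The formal partial derivative. If \<open>X\<^sub>i\<close> does not occur in the monomial \<open>e\<close>, the truncated
  subtraction leaves \<open>e\<close> unchanged, but then the coefficient is zero.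
\<close>

definition mpoly_deriv :: "'n \<Rightarrow> ('n, 'a::comm_semiring_1) mpoly \<Rightarrow> ('n, 'a) mpoly" where
  "mpoly_deriv i p =
     (\<Sum>e\<in>Poly_Mapping.keys p.
        Poly_Mapping.single (e - Poly_Mapping.single i 1)
          (of_nat (Poly_Mapping.lookup e i) * Poly_Mapping.lookup p e))"

text \<open>
  A polynomial map is given by its tuple of component polynomials; \<open>poly_map F\<close> is the induced
  function. Over an infinite field the function determines the tuple.
\<close>

definition poly_map :: "('n::finite, 'a::comm_semiring_1) mpoly ^ 'n \<Rightarrow> 'a ^ 'n \<Rightarrow> 'a ^ 'n" where
  "poly_map F x = (\<chi> i. mpoly_eval (F $ i) x)"

definition invertible_poly_map :: "('n::finite, 'a::comm_semiring_1) mpoly ^ 'n \<Rightarrow> bool" where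
  "invertible_poly_map F \<longleftrightarrow>
     (\<exists>G :: ('n, 'a) mpoly ^ 'n. poly_map G \<circ> poly_map F = id \<and> poly_map F \<circ> poly_map G = id)"

definition Jac :: "('n::finite, 'a::comm_semiring_1) mpoly ^ 'n \<Rightarrow> ('n, 'a) mpoly ^ 'n ^ 'n" where
  "Jac F = (\<chi> i j. mpoly_deriv j (F $ i))"

definition Jac_at :: "('n::finite, 'a::comm_semiring_1) mpoly ^ 'n \<Rightarrow> 'a ^ 'n \<Rightarrow> 'a ^ 'n ^ 'n" where
  "Jac_at F x = map_matrix (\<lambda>p. mpoly_eval p x) (Jac F)"

definition mat_scale :: "'a::times \<Rightarrow> 'a ^ 'n ^ 'm \<Rightarrow> 'a ^ 'n ^ 'm" where
  "mat_scale c A = map_matrix ((*) c) A"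

end

theory Submission
  imports Defs "HOL-Computational_Algebra.Computational_Algebra"
    "HOL-Computational_Algebra.Field_as_Ring" "HOL-Library.Function_Algebras"
    "HOL-Complex_Analysis.Complex_Analysis"
begin

text \<open>
  The determinant formula. Let \<open>A\<^sub>0, \<dots>, A\<^sub>s\<close> be values of the Jacobian matrix. The function
  \<open>det (m A\<^sub>0 + \<Sum>\<^sub>j b\<^sub>j (A\<^sub>j - A\<^sub>0))\<close> is a polynomial in \<open>b\<close> of degree at most \<open>n\<close>. By hypothesis it has
  the value \<open>\<mu>\<close> at all natural points with \<open>\<Sum>\<^sub>j b\<^sub>j \<le> m\<close>. Since \<open>n \<le> m\<close>, these points determine such a
  polynomial (\<open>deg_le_eq_0_if_zero_on_simplex\<close>), so it is constant. Homogeneity of the determinant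
  gives the formula for all weights (\<open>det_combination\<close>).

  Injectivity. The difference of two values of \<open>F\<close> is the integral of the Jacobian along the
  segment, applied to the difference of the arguments. An exact quadrature rule turns the integral
  into a linear combination of Jacobians with weights of sum 1, and such a combination has
  determinant \<open>det (J F)\<close>. So if this constant is not 0, then \<open>F\<close> is injective
  (\<open>poly_map_inj_if_combinations_nonsingular\<close>).

  Invertibility of an injective polynomial map \<open>f\<close> with constant nonzero Jacobian determinant
  (locale \<open>unimodular_injection\<close>). Let \<open>U\<close> be the image, which is open, and \<open>g\<close> the inverse on \<open>U\<close>. The
  coordinates of \<open>x\<close> are algebraic over the components of \<open>f\<close>, so there is a polynomial \<open>a \<noteq> 0\<close>
  such that \<open>a g\<close> grows polynomially. Fix a direction \<open>v\<close> at which the leading form of \<open>a\<close> does not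
  vanish. On each line in direction \<open>v\<close> through a point of \<open>U\<close> only finitely many points can lie
  outside \<open>U\<close>, and \<open>g\<close> is rational on the line with denominator \<open>a ^ 2\<close>, by Liouville's theorem.

  The main point is that these rational functions have no poles (\<open>inverse_pole_free\<close>). The Taylor
  coefficients of \<open>g\<close> along the line \<open>f x + s v\<close> are polynomials in \<open>x\<close>, because the inverse
  Jacobian is polynomial. When \<open>x\<close> runs through a line \<open>x\<^sub>0 + \<lambda> u\<close>, they form a power series over
  \<open>\<complex>[\<lambda>]\<close> that is rational. By Fatou's lemma it has a denominator with constant term 1, and since
  \<open>a ^ 2\<close> has a constant leading coefficient in \<open>s\<close>, so has this denominator
  (\<open>rational_family_denominator\<close>). So the product of its roots in \<open>s\<close> is independent of \<open>\<lambda>\<close>. If there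
  were a pole on the line through \<open>f x\<^sub>0\<close>, one could compare \<open>x\<^sub>0\<close> with a point \<open>x\<^sub>1\<close> whose image
  lies on the same line close to the pole. For \<open>x\<^sub>1\<close> one root would be close to 0 and the others
  bounded, whereas for \<open>x\<^sub>0\<close> the product of roots takes only finitely many nonzero values.

  So \<open>g\<close> is polynomial of bounded degree on all lines in direction \<open>v\<close>, and these lines lie in \<open>U\<close>.
  As this holds for all \<open>v\<close> outside a hypersurface, \<open>U\<close> is the whole space and \<open>g\<close> is polynomial.
\<close>

no_notation fps_nth (infixl \<open>$\<close> 75)

section \<open>Evaluation of polynomials in several variables\<close>

definition monomial_at :: "('n \<Rightarrow>\<^sub>0 nat) \<Rightarrow> 'a::comm_semiring_1 ^ 'n::finite \<Rightarrow> 'a" where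
  "monomial_at e x = (\<Prod>i\<in>UNIV. x $ i ^ Poly_Mapping.lookup e i)"

lemma monomial_at_0 [simp]: "monomial_at 0 x = 1"
  by (simp add: monomial_at_def)

lemma monomial_at_add: "monomial_at (e + e') x = monomial_at e x * monomial_at e' x"
  by (simp add: monomial_at_def lookup_add power_add prod.distrib)

lemma mpoly_eval_superset:
  assumes "finite A" "Poly_Mapping.keys p \<subseteq> A"
  shows "mpoly_eval p x = (\<Sum>e\<in>A. Poly_Mapping.lookup p e * monomial_at e x)"
  unfolding mpoly_eval_def monomial_at_def
  by (rule sum.mono_neutral_left) (use assms in \<open>auto simp: in_keys_iff\<close>)

lemma mpoly_eval_0 [simp]: "mpoly_eval 0 x = 0"
  by (simp add: mpoly_eval_def)

lemma mpoly_eval_single [simp]: "mpoly_eval (Poly_Mapping.single e c) x = c * monomial_at e x"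
  by (subst mpoly_eval_superset[of "{e}"]) (auto simp: lookup_single)

lemma mpoly_eval_const [simp]: "mpoly_eval (mpoly_const c) x = c"
  by (simp add: mpoly_const_def)

lemma mpoly_eval_1 [simp]: "mpoly_eval 1 x = 1"
  by (metis lookup_one_zero monomial_at_0 mpoly_eval_single mult_1 single_one)

lemma mpoly_eval_add: "mpoly_eval (p + q) x = mpoly_eval p x + mpoly_eval q x"
proof -
  let ?A = "Poly_Mapping.keys p \<union> Poly_Mapping.keys q"
  have "Poly_Mapping.keys (p + q) \<subseteq> ?A" by (rule Poly_Mapping.keys_add)
  then show ?thesis
    by (simp add: mpoly_eval_superset[of ?A] lookup_add sum.distrib distrib_right)
qed

lemma mpoly_eval_sum: "mpoly_eval (\<Sum>a\<in>A. f a) x = (\<Sum>a\<in>A. mpoly_eval (f a) x)"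
  by (induction A rule: infinite_finite_induct) (auto simp: mpoly_eval_add)

lemma mpoly_eq_sum_singles:
  "p = (\<Sum>e\<in>Poly_Mapping.keys p. Poly_Mapping.single e (Poly_Mapping.lookup p e))"
  by (rule poly_mapping_eqI)
     (auto simp: lookup_sum lookup_single when_def in_keys_iff)

lemma mpoly_eval_mult: "mpoly_eval (p * q) x = mpoly_eval p x * mpoly_eval q x"
proof -
  have "p * q = (\<Sum>e\<in>Poly_Mapping.keys p. \<Sum>e'\<in>Poly_Mapping.keys q.
      Poly_Mapping.single (e + e') (Poly_Mapping.lookup p e * Poly_Mapping.lookup q e'))"
    by (subst mpoly_eq_sum_singles[of p], subst mpoly_eq_sum_singles[of q])
       (simp add: sum_product mult_single)
  then have "mpoly_eval (p * q) x = (\<Sum>e\<in>Poly_Mapping.keys p. \<Sum>e'\<in>Poly_Mapping.keys q.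
      Poly_Mapping.lookup p e * monomial_at e x * (Poly_Mapping.lookup q e' * monomial_at e' x))"
    by (simp add: mpoly_eval_sum monomial_at_add mult_ac)
  then show ?thesis
    by (simp add: mpoly_eval_superset[of "Poly_Mapping.keys p" p]
        mpoly_eval_superset[of "Poly_Mapping.keys q" q] sum_product)
qed

lemma mpoly_eval_prod: "mpoly_eval (\<Prod>a\<in>A. f a) x = (\<Prod>a\<in>A. mpoly_eval (f a) x)"
  by (induction A rule: infinite_finite_induct) (auto simp: mpoly_eval_mult)

lemma mpoly_eval_uminus:
  fixes p :: "('n::finite, 'a::comm_ring_1) mpoly"
  shows "mpoly_eval (- p) x = - mpoly_eval p x"
  using mpoly_eval_add[of p "- p" x] by (simp add: eq_neg_iff_add_eq_0 add.commute)

lemma mpoly_eval_of_nat [simp]: "mpoly_eval (of_nat k) x = of_nat k"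
  by (induction k) (auto simp: mpoly_eval_add)

lemma mpoly_eval_of_int [simp]:
  "mpoly_eval (of_int k :: ('n::finite, 'a::comm_ring_1) mpoly) x = of_int k"
  by (cases k) (auto simp: mpoly_eval_add mpoly_eval_uminus simp flip: of_nat_Suc)

lemma mpoly_eval_det:
  fixes A :: "('n::finite, 'a::comm_ring_1) mpoly ^ 'k::finite ^ 'k"
  shows "mpoly_eval (det A) x = det (map_matrix (\<lambda>p. mpoly_eval p x) A)"
  by (simp add: det_def mpoly_eval_sum mpoly_eval_mult mpoly_eval_prod map_matrix_def)

text \<open>
  Monomials are linearly independent as functions over a domain of characteristic 0. The induction runs over the
  set of variables in use: the last variable is split off by comparing coefficients of a polynomial
  in that variable alone. The exponents only have to differ on the variables in use, which lets
  the induction pass to the exponents with a given value at the last variable.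
\<close>

lemma monomials_independent:
  fixes c :: "('n \<Rightarrow> nat) \<Rightarrow> 'a::{idom,ring_char_0}"
  assumes "finite S" "finite E"
    and "\<And>e e'. e \<in> E \<Longrightarrow> e' \<in> E \<Longrightarrow> (\<forall>i\<in>S. e i = e' i) \<Longrightarrow> e = e'"
    and "\<And>x :: 'n \<Rightarrow> 'a. (\<Sum>e\<in>E. c e * (\<Prod>i\<in>S. x i ^ e i)) = 0"
    and "e \<in> E"
  shows "c e = 0"
  using assms
proof (induction S arbitrary: E e rule: finite_induct)
  case empty
  have "E = {e}" using empty by auto
  then show ?case using empty(3)[of undefined] by simp
next
  case (insert i S)
  let ?Ek = "{e' \<in> E. e' i = e i}"
  have van: "(\<Sum>e'\<in>?Ek. c e' * (\<Prod>j\<in>S. x j ^ e' j)) = 0" for x :: "'n \<Rightarrow> 'a"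
  proof -
    define P where "P = (\<Sum>e'\<in>E. monom (c e' * (\<Prod>j\<in>S. x j ^ e' j)) (e' i))"
    have "poly P z = 0" for z
    proof -
      have "poly P z = (\<Sum>e'\<in>E. c e' * (\<Prod>j\<in>insert i S. (x(i := z)) j ^ e' j))"
        unfolding P_def poly_sum poly_monom
      proof (rule sum.cong[OF refl])
        fix e' assume "e' \<in> E"
        have "(\<Prod>j\<in>S. (x(i := z)) j ^ e' j) = (\<Prod>j\<in>S. x j ^ e' j)"
          using insert.hyps by (intro prod.cong) auto
        then show "c e' * (\<Prod>j\<in>S. x j ^ e' j) * z ^ e' i
            = c e' * (\<Prod>j\<in>insert i S. (x(i := z)) j ^ e' j)"
          using insert.hyps by simp
      qed
      then show ?thesis using insert.prems(3) by simp
    qed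
    then have "P = 0" using poly_all_0_iff_0 by blast
    then have "coeff P (e i) = 0" by simp
    moreover have "coeff P (e i) = (\<Sum>e'\<in>E. if e' i = e i then c e' * (\<Prod>j\<in>S. x j ^ e' j) else 0)"
      by (simp add: P_def coeff_sum)
    ultimately show ?thesis
      using insert.prems(1) by (simp add: sum.If_cases Int_def)
  qed
  show ?case
  proof (rule insert.IH[of ?Ek])
    show "finite ?Ek" using insert.prems(1) by simp
  next
    fix a b assume "a \<in> ?Ek" "b \<in> ?Ek" "\<forall>j\<in>S. a j = b j"
    then show "a = b" using insert.prems(2)[of a b] by auto
  qed (use van insert.prems in auto)
qed

lemma mpoly_eq_0I:
  fixes p :: "('n::finite, 'a::{idom,ring_char_0}) mpoly"
  assumes "\<And>x. mpoly_eval p x = 0"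
  shows "p = 0"
proof (rule poly_mapping_eqI)
  fix e
  let ?E = "Poly_Mapping.lookup ` Poly_Mapping.keys p"
  let ?c = "\<lambda>e. Poly_Mapping.lookup p (Abs_poly_mapping e)"
  have "Poly_Mapping.lookup p e = 0" if "e \<in> Poly_Mapping.keys p"
  proof -
    have "?c (Poly_Mapping.lookup e) = 0"
    proof (rule monomials_independent[of UNIV ?E])
      fix x :: "'n \<Rightarrow> 'a"
      have "(\<Sum>e\<in>?E. ?c e * (\<Prod>i\<in>UNIV. x i ^ e i)) = mpoly_eval p (\<chi> i. x i)"
        unfolding mpoly_eval_def
        by (subst sum.reindex) (auto simp: inj_on_def lookup_inject Poly_Mapping.lookup_inverse)
      then show "(\<Sum>e\<in>?E. ?c e * (\<Prod>i\<in>UNIV. x i ^ e i)) = 0" using assms by simp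
    qed (use that in auto)
    then show ?thesis by (simp add: Poly_Mapping.lookup_inverse)
  qed
  then show "Poly_Mapping.lookup p e = Poly_Mapping.lookup 0 e"
    by (auto simp: in_keys_iff)
qed

lemma mpoly_eqI:
  fixes p q :: "('n::finite, 'a::{idom,ring_char_0}) mpoly"
  assumes "\<And>x. mpoly_eval p x = mpoly_eval q x"
  shows "p = q"
proof -
  have "p + - q = 0"
    by (rule mpoly_eq_0I) (simp only: mpoly_eval_add mpoly_eval_uminus assms right_minus)
  then show ?thesis by (simp add: eq_neg_iff_add_eq_0)
qed

lemma has_derivative_monomial_at:
  fixes x :: "complex ^ 'n::finite"
  shows "(monomial_at e has_derivative
    (\<lambda>h. \<Sum>j\<in>UNIV. of_nat (Poly_Mapping.lookup e j) * monomial_at (e - Poly_Mapping.single j 1) x * h $ j)) (at x)"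
proof -
  have "((\<lambda>x. \<Prod>j\<in>UNIV. x $ j ^ Poly_Mapping.lookup e j) has_derivative
     (\<lambda>h. \<Sum>j\<in>UNIV. (of_nat (Poly_Mapping.lookup e j) * x $ j ^ (Poly_Mapping.lookup e j - 1) * h $ j)
         * (\<Prod>l\<in>UNIV - {j}. x $ l ^ Poly_Mapping.lookup e l))) (at x)"
    by (intro has_derivative_prod)
       (auto intro!: derivative_eq_intros bounded_linear_imp_has_derivative[OF bounded_linear_vec_nth]
         simp: mult_ac)
  moreover have "x $ j ^ (Poly_Mapping.lookup e j - 1) * (\<Prod>l\<in>UNIV - {j}. x $ l ^ Poly_Mapping.lookup e l)
      = monomial_at (e - Poly_Mapping.single j 1) x" for j
  proof -
    have "(\<Prod>l\<in>UNIV - {j}. x $ l ^ Poly_Mapping.lookup (e - Poly_Mapping.single j 1) l)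
       = (\<Prod>l\<in>UNIV - {j}. x $ l ^ Poly_Mapping.lookup e l)"
      by (intro prod.cong) (auto simp: lookup_minus lookup_single when_def)
    then show ?thesis
      unfolding monomial_at_def by (subst prod.remove[of UNIV j]) (auto simp: lookup_minus)
  qed
  ultimately show ?thesis
    unfolding monomial_at_def[abs_def]
    by (elim has_derivative_eq_rhs) (auto simp: fun_eq_iff mult_ac intro!: sum.cong)
qed

lemma mpoly_eval_deriv:
  "mpoly_eval (mpoly_deriv j p) x = (\<Sum>e\<in>Poly_Mapping.keys p.
     Poly_Mapping.lookup p e * (of_nat (Poly_Mapping.lookup e j) * monomial_at (e - Poly_Mapping.single j 1) x))"
  by (simp add: mpoly_deriv_def mpoly_eval_sum mult_ac)

lemma has_derivative_mpoly_eval: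
  fixes p :: "('n::finite, complex) mpoly"
  shows "(mpoly_eval p has_derivative (\<lambda>h. \<Sum>j\<in>UNIV. mpoly_eval (mpoly_deriv j p) x * h $ j)) (at x)"
proof -
  have "((\<lambda>x. \<Sum>e\<in>Poly_Mapping.keys p. Poly_Mapping.lookup p e * monomial_at e x) has_derivative
     (\<lambda>h. \<Sum>e\<in>Poly_Mapping.keys p. Poly_Mapping.lookup p e *
       (\<Sum>j\<in>UNIV. of_nat (Poly_Mapping.lookup e j) * monomial_at (e - Poly_Mapping.single j 1) x * h $ j))) (at x)"
    by (intro has_derivative_sum has_derivative_mult_right has_derivative_monomial_at)
  moreover have "(\<lambda>h. \<Sum>e\<in>Poly_Mapping.keys p. Poly_Mapping.lookup p e *
       (\<Sum>j\<in>UNIV. of_nat (Poly_Mapping.lookup e j) * monomial_at (e - Poly_Mapping.single j 1) x * h $ j))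
     = (\<lambda>h. \<Sum>j\<in>UNIV. mpoly_eval (mpoly_deriv j p) x * h $ j)"
  proof
    fix h
    show "(\<Sum>e\<in>Poly_Mapping.keys p. Poly_Mapping.lookup p e *
       (\<Sum>j\<in>UNIV. of_nat (Poly_Mapping.lookup e j) * monomial_at (e - Poly_Mapping.single j 1) x * h $ j))
     = (\<Sum>j\<in>UNIV. mpoly_eval (mpoly_deriv j p) x * h $ j)"
      unfolding mpoly_eval_deriv sum_distrib_left sum_distrib_right
      by (subst sum.swap) (simp add: mult_ac)
  qed
  ultimately show ?thesis
    by (simp add: mpoly_eval_superset[OF finite_keys subset_refl, abs_def])
qed

section \<open>Polynomial functions\<close>

text \<open>
  The analytic part of the proof works with functions and never looks at coefficients. Generating
  the polynomial functions from constants and coordinates gives it induction over the way such a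
  function is built; the link to \<^const>\<open>mpoly_eval\<close> is needed only at both ends of the argument.
\<close>

inductive polyfun :: "(complex ^ 'n::finite \<Rightarrow> complex) \<Rightarrow> bool" where
  const: "polyfun (\<lambda>x. c)"
| coord: "polyfun (\<lambda>x. x $ i)"
| add: "polyfun f \<Longrightarrow> polyfun g \<Longrightarrow> polyfun (\<lambda>x. f x + g x)"
| mult: "polyfun f \<Longrightarrow> polyfun g \<Longrightarrow> polyfun (\<lambda>x. f x * g x)"

lemma polyfun_sum: "(\<And>a. a \<in> A \<Longrightarrow> polyfun (f a)) \<Longrightarrow> polyfun (\<lambda>x. \<Sum>a\<in>A. f a x)"
  by (induction A rule: infinite_finite_induct) (auto intro: polyfun.intros)

lemma polyfun_prod: "(\<And>a. a \<in> A \<Longrightarrow> polyfun (f a)) \<Longrightarrow> polyfun (\<lambda>x. \<Prod>a\<in>A. f a x)"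
  by (induction A rule: infinite_finite_induct) (auto intro: polyfun.intros)

lemma polyfun_power: "polyfun f \<Longrightarrow> polyfun (\<lambda>x. f x ^ k)"
  by (induction k) (auto intro: polyfun.intros)

lemma polyfun_diff: "polyfun f \<Longrightarrow> polyfun g \<Longrightarrow> polyfun (\<lambda>x. f x - g x)"
  using polyfun.add[OF _ polyfun.mult[OF polyfun.const, of g "- 1"]] by simp

lemma polyfun_cmult: "polyfun f \<Longrightarrow> polyfun (\<lambda>x. c * f x)"
  by (intro polyfun.mult polyfun.const)

lemma polyfun_poly: "polyfun f \<Longrightarrow> polyfun (\<lambda>x. poly P (f x))"
  by (induction P) (auto intro: polyfun.intros)

lemma polyfun_compose:
  assumes "polyfun p" "\<And>i. polyfun (\<lambda>x. f x $ i)"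
  shows "polyfun (\<lambda>x. p (f x))"
  using assms by induction (auto intro: polyfun.intros)

lemma polyfun_monomial_at: "polyfun (monomial_at e)"
  unfolding monomial_at_def[abs_def] by (intro polyfun_prod polyfun_power polyfun.coord)

lemma polyfun_mpoly_eval: "polyfun (mpoly_eval p)"
  unfolding mpoly_eval_superset[OF finite_keys subset_refl, abs_def]
  by (intro polyfun_sum polyfun_cmult polyfun_monomial_at)

lemma polyfun_imp_mpoly:
  fixes f :: "complex ^ 'n::finite \<Rightarrow> complex"
  assumes "polyfun f"
  obtains p where "f = mpoly_eval p"
proof -
  have "\<exists>p. \<forall>x. f x = mpoly_eval p x" using assms
  proof induction
    case (const c)
    show ?case by (rule exI[of _ "mpoly_const c"]) simp
  next
    case (coord i)
    have "monomial_at (Poly_Mapping.single i 1) x = x $ i" for x :: "complex ^ 'n"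
    proof -
      have "monomial_at (Poly_Mapping.single i 1) x = (\<Prod>j\<in>UNIV. if j = i then x $ j else 1)"
        unfolding monomial_at_def by (intro prod.cong) (auto simp: lookup_single)
      then show ?thesis by simp
    qed
    then show ?case by (intro exI[of _ "Poly_Mapping.single (Poly_Mapping.single i 1) 1"]) simp
  next
    case (add f g)
    then show ?case by (metis mpoly_eval_add)
  next
    case (mult f g)
    then show ?case by (metis mpoly_eval_mult)
  qed
  then show ?thesis using that by blast
qed

lemma polyfun_curve:
  assumes "polyfun f"
  shows "\<exists>P. \<forall>t. f (\<chi> i. poly (r i) t) = poly P t"
  using assms
proof induction
  case (const c)
  show ?case by (rule exI[of _ "[:c:]"]) simp
next
  case (coord i)
  show ?case by (rule exI[of _ "r i"]) simp
next
  case (add f g)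
  then show ?case by (metis poly_add)
next
  case (mult f g)
  then show ?case by (metis poly_mult)
qed

lemma polyfun_line:
  assumes "polyfun f"
  obtains P where "\<And>t. f (x + t *s u) = poly P t"
proof -
  have "x + t *s u = (\<chi> i. poly [:x $ i, u $ i:] t)" for t by (simp add: vec_eq_iff)
  then show ?thesis
    using polyfun_curve[OF assms, of "\<lambda>i. [:x $ i, u $ i:]"] that by metis
qed

definition poly_growth :: "('a::real_normed_vector \<Rightarrow> real) \<Rightarrow> bool" where
  "poly_growth h \<longleftrightarrow> (\<exists>C k. C \<ge> 0 \<and> (\<forall>x. \<bar>h x\<bar> \<le> C * (1 + norm x) ^ k))"

lemma poly_growth_const: "poly_growth (\<lambda>x. c)"
  unfolding poly_growth_def by (intro exI[of _ "\<bar>c\<bar>"] exI[of _ 0]) simp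

lemma poly_growth_add:
  assumes "poly_growth f" "poly_growth g"
  shows "poly_growth (\<lambda>x. f x + g x)"
proof -
  obtain C k D l where *: "C \<ge> 0" "\<And>x. \<bar>f x\<bar> \<le> C * (1 + norm x) ^ k"
    "D \<ge> 0" "\<And>x. \<bar>g x\<bar> \<le> D * (1 + norm x) ^ l"
    using assms unfolding poly_growth_def by blast
  have "\<bar>f x + g x\<bar> \<le> (C + D) * (1 + norm x) ^ (k + l)" for x
  proof -
    have "\<bar>f x\<bar> \<le> C * (1 + norm x) ^ (k + l)"
      by (rule order_trans[OF *(2)]) (intro mult_left_mono power_increasing, auto simp: *)
    moreover have "\<bar>g x\<bar> \<le> D * (1 + norm x) ^ (k + l)"
      by (rule order_trans[OF *(4)]) (intro mult_left_mono power_increasing, auto simp: *)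
    ultimately show ?thesis by (simp add: distrib_right)
  qed
  then show ?thesis using *(1,3) unfolding poly_growth_def by (intro exI[of _ "C + D"]) auto
qed

lemma poly_growth_mult:
  assumes "poly_growth f" "poly_growth g"
  shows "poly_growth (\<lambda>x. f x * g x)"
proof -
  obtain C k D l where *: "C \<ge> 0" "\<And>x. \<bar>f x\<bar> \<le> C * (1 + norm x) ^ k"
    "D \<ge> 0" "\<And>x. \<bar>g x\<bar> \<le> D * (1 + norm x) ^ l"
    using assms unfolding poly_growth_def by blast
  have "\<bar>f x * g x\<bar> \<le> (C * D) * (1 + norm x) ^ (k + l)" for x
    using mult_mono[OF *(2)[of x] *(4)[of x]] *(1,3)
    by (simp add: abs_mult power_add mult_ac)
  then show ?thesis using *(1,3) unfolding poly_growth_def by (intro exI[of _ "C * D"]) auto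
qed

lemma poly_growth_power: "poly_growth f \<Longrightarrow> poly_growth (\<lambda>x. f x ^ k)"
  by (induction k) (auto intro: poly_growth_const poly_growth_mult)

lemma poly_growth_sum: "(\<And>a. a \<in> A \<Longrightarrow> poly_growth (f a)) \<Longrightarrow> poly_growth (\<lambda>x. \<Sum>a\<in>A. f a x)"
  by (induction A rule: infinite_finite_induct) (auto intro: poly_growth_const poly_growth_add)

lemma poly_growth_prod: "(\<And>a. a \<in> A \<Longrightarrow> poly_growth (f a)) \<Longrightarrow> poly_growth (\<lambda>x. \<Prod>a\<in>A. f a x)"
  by (induction A rule: infinite_finite_induct) (auto intro: poly_growth_const poly_growth_mult)

lemma poly_growth_mono:
  assumes "poly_growth g" "\<And>x. \<bar>f x\<bar> \<le> g x"
  shows "poly_growth f"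
  using assms unfolding poly_growth_def by (meson abs_le_D1 order_trans)

lemma poly_growth_norm_polyfun:
  fixes f :: "complex ^ 'n::finite \<Rightarrow> complex"
  shows "polyfun f \<Longrightarrow> poly_growth (\<lambda>x. norm (f x))"
proof (induction rule: polyfun.induct)
  case (coord i)
  have "\<bar>norm (x $ i)\<bar> \<le> 1 * (1 + norm x) ^ 1" for x :: "complex ^ 'n"
    using Finite_Cartesian_Product.norm_nth_le[of x i] by simp
  then show ?case unfolding poly_growth_def by (intro exI[of _ 1]) auto
next
  case (add f g)
  show ?case
    by (rule poly_growth_mono[OF poly_growth_add[OF add.IH]]) (auto intro: norm_triangle_ineq)
qed (auto simp: norm_mult intro: poly_growth_const poly_growth_mult)

lemma eventually_line_in_open:
  fixes x :: "complex ^ 'n::finite"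
  assumes "open U" "x \<in> U"
  shows "eventually (\<lambda>t. x + t *s u \<in> U) (at 0)"
proof -
  have "((\<lambda>t. x + t *s u) \<longlongrightarrow> x) (at 0)"
    by (rule vec_tendstoI) (auto intro!: tendsto_eq_intros)
  then show ?thesis using topological_tendstoD[OF _ assms] by blast
qed

lemma poly_eq_0_if_eventually_0:
  fixes P :: "complex poly"
  assumes "eventually (\<lambda>t. poly P t = 0) (at z)"
  shows "P = 0"
proof (rule ccontr)
  assume "P \<noteq> 0"
  then have "finite {t. poly P t = 0}" by (rule poly_roots_finite)
  then have "eventually (\<lambda>t. t \<notin> {t. poly P t = 0}) (at z)"
    using islimpt_finite[of "{t. poly P t = 0}" z] by (simp add: islimpt_iff_eventually)
  with assms have "eventually (\<lambda>t::complex. False) (at z)"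
    by eventually_elim simp
  then show False by (simp add: trivial_limit_def[symmetric])
qed

text \<open>
  Any point can be joined to a point of the open set by a complex line, and on that line the
  function is a polynomial in one variable with infinitely many zeros.
\<close>

lemma polyfun_eq_0_if_eq_0_on_open:
  assumes "polyfun f" "open U" "U \<noteq> {}" "\<And>x. x \<in> U \<Longrightarrow> f x = 0"
  shows "f z = 0"
proof -
  obtain x where x: "x \<in> U" using assms(3) by blast
  obtain P where P: "\<And>t. f (x + t *s (z - x)) = poly P t"
    using polyfun_line[OF assms(1)] by blast
  have "eventually (\<lambda>t. poly P t = 0) (at 0)"
    using eventually_line_in_open[OF assms(2) x, of "z - x"]
  proof eventually_elim
    case (elim t)
    then show ?case using assms(4) P[of t] by metis
  qed
  then have "P = 0" by (rule poly_eq_0_if_eventually_0)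
  moreover have "x + 1 *s (z - x) = z" by (simp add: vec_eq_iff)
  ultimately show ?thesis using P[of 1] by simp
qed

section \<open>Interpolation and exact quadrature\<close>

lemma lagrange_interpolation:
  obtains l :: "nat \<Rightarrow> 'a::field_char_0 poly" where
    "\<And>p. degree p \<le> d \<Longrightarrow> p = (\<Sum>k\<le>d. smult (poly p (of_nat k)) (l k))"
proof
  define l :: "nat \<Rightarrow> 'a poly" where
    "l k = (\<Prod>j\<in>{..d} - {k}. smult (inverse (of_nat k - of_nat j)) [:- of_nat j, 1:])" for k
  have deg: "degree (l k) \<le> d" if "k \<le> d" for k
  proof -
    have "degree (l k) \<le> (\<Sum>j\<in>{..d} - {k}. degree (smult (inverse (of_nat k - of_nat j)) [:- of_nat j, 1::'a:]))"
      unfolding l_def by (rule degree_prod_sum_le[unfolded o_def]) simp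
    also have "\<dots> \<le> (\<Sum>j\<in>{..d} - {k}. 1)"
      by (intro sum_mono) auto
    finally show ?thesis using that by simp
  qed
  have val: "poly (l k) (of_nat m) = (if m = k then 1 else 0)" if "k \<le> d" "m \<le> d" for k m
  proof (cases "m = k")
    case True
    have "inverse (of_nat k - of_nat j) * (of_nat k - of_nat j) = (1::'a)" if "j \<noteq> k" for j
      using that by simp
    then show ?thesis
      using True by (auto simp: l_def poly_prod algebra_simps intro!: prod.neutral)
  qed (use that in \<open>auto simp: l_def poly_prod\<close>)
  show "p = (\<Sum>k\<le>d. smult (poly p (of_nat k)) (l k))" if "degree p \<le> d" for p
  proof (rule poly_eqI_degree)
    fix z assume "z \<in> (of_nat ` {..d} :: 'a set)"
    then obtain m where m: "m \<le> d" "z = of_nat m" by auto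
    have "poly (\<Sum>k\<le>d. smult (poly p (of_nat k)) (l k)) z = (\<Sum>k\<le>d. if m = k then poly p (of_nat k) else 0)"
      unfolding poly_sum using m val by (intro sum.cong) auto
    then show "poly p z = poly (\<Sum>k\<le>d. smult (poly p (of_nat k)) (l k)) z"
      using m by simp
  next
    have "card (of_nat ` {..d} :: 'a set) = Suc d"
      by (subst card_image) (auto simp: inj_on_def)
    then show "degree p < card (of_nat ` {..d} :: 'a set)"
      "degree (\<Sum>k\<le>d. smult (poly p (of_nat k)) (l k)) < card (of_nat ` {..d} :: 'a set)"
      using that deg by (auto simp: less_Suc_eq_le intro!: degree_sum_le order_trans[OF degree_smult_le])
  qed
qed

text \<open>
  Integrating the Lagrange basis over the unit interval gives a rule that is exact in bounded
  degree. It replaces the mean value integral of a Jacobian along a segment by a finite linear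
  combination of its values.
\<close>

lemma exact_quadrature:
  obtains b :: "nat \<Rightarrow> 'a::field_char_0" where
    "\<And>p. degree p \<le> Suc d \<Longrightarrow> (\<Sum>k\<le>d. b k * poly (pderiv p) (of_nat k)) = poly p 1 - poly p 0"
proof -
  \<comment> \<open>\<open>I q\<close> is the integral of \<open>q\<close> from 0 to 1.\<close>
  define I :: "'a poly \<Rightarrow> 'a" where "I q = (\<Sum>m\<le>d. coeff q m / of_nat (Suc m))" for q
  obtain l :: "nat \<Rightarrow> 'a poly" where
    l: "\<And>p. degree p \<le> d \<Longrightarrow> p = (\<Sum>k\<le>d. smult (poly p (of_nat k)) (l k))"
    by (rule lagrange_interpolation[of d]) blast
  have "(\<Sum>k\<le>d. I (l k) * poly (pderiv p) (of_nat k)) = poly p 1 - poly p 0" if "degree p \<le> Suc d" for p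
  proof -
    have "degree (pderiv p) \<le> d" using that by (simp add: degree_pderiv)
    then have "I (pderiv p) = I (\<Sum>k\<le>d. smult (poly (pderiv p) (of_nat k)) (l k))"
      using l by metis
    also have "\<dots> = (\<Sum>m\<le>d. \<Sum>k\<le>d. poly (pderiv p) (of_nat k) * (coeff (l k) m / of_nat (Suc m)))"
      by (simp add: I_def coeff_sum sum_divide_distrib)
    also have "\<dots> = (\<Sum>k\<le>d. poly (pderiv p) (of_nat k) * I (l k))"
      by (subst sum.swap) (simp add: I_def sum_distrib_left)
    finally have "(\<Sum>k\<le>d. I (l k) * poly (pderiv p) (of_nat k)) = I (pderiv p)"
      by (simp add: mult.commute)
    also have "\<dots> = (\<Sum>m\<le>d. coeff p (Suc m))"
      unfolding I_def by (intro sum.cong) (auto simp: coeff_pderiv simp del: of_nat_Suc)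
    also have "\<dots> = (\<Sum>m\<le>Suc d. coeff p m) - coeff p 0"
      by (subst sum.atMost_Suc_shift) simp
    also have "(\<Sum>m\<le>Suc d. coeff p m) = poly p 1"
      using poly_as_sum_of_monoms'[OF that] poly_altdef[of p 1]
      by (subst poly_altdef, intro sum.mono_neutral_cong_right) (use that in \<open>auto simp: coeff_eq_0\<close>)
    finally show ?thesis by (simp add: poly_0_coeff_0)
  qed
  then show ?thesis by (rule that[of "\<lambda>k. I (l k)"])
qed

section \<open>Denominators of power series over a polynomial ring\<close>

text \<open>
  A monic divisor is determined by its multiset of roots, which is contained in that of \<open>Q\<close>.
\<close>

lemma finite_monic_divisors:
  fixes Q :: "complex poly"
  assumes "Q \<noteq> 0"
  shows "finite {B. B dvd Q \<and> lead_coeff B = 1}"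
proof (rule finite_subset)
  let ?L = "{xs. set xs \<subseteq> set_mset (proots Q) \<and> length xs \<le> size (proots Q)}"
  show "finite ((\<lambda>xs. \<Prod>z\<leftarrow>xs. [:- z, 1:]) ` ?L)"
    by (intro finite_imageI finite_lists_length_le) auto
  show "{B. B dvd Q \<and> lead_coeff B = 1} \<subseteq> (\<lambda>xs. \<Prod>z\<leftarrow>xs. [:- z, 1:]) ` ?L"
  proof
    fix B assume "B \<in> {B. B dvd Q \<and> lead_coeff B = 1}"
    then obtain R where R: "Q = B * R" and lc: "lead_coeff B = 1" by (auto simp: dvd_def)
    then have sub: "proots B \<subseteq># proots Q" using assms by (simp add: proots_mult)
    obtain xs where xs: "mset xs = proots B" using ex_mset by blast
    have "B = (\<Prod>z\<in>#proots B. [:- z, 1:])"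
      using complex_poly_decompose_multiset[of B] lc by simp
    also have "\<dots> = (\<Prod>z\<leftarrow>xs. [:- z, 1:])"
      by (simp flip: xs add: prod_mset_prod_list mset_map[symmetric] del: mset_map)
    finally have "B = (\<Prod>z\<leftarrow>xs. [:- z, 1:])" .
    moreover have "xs \<in> ?L"
      using sub set_mset_mono[OF sub] size_mset_mono[OF sub] by (simp flip: xs)
    ultimately show "B \<in> (\<lambda>xs. \<Prod>z\<leftarrow>xs. [:- z, 1:]) ` ?L" by blast
  qed
qed

text \<open>
  Over the field of fractions of \<open>\<complex>[\<lambda>]\<close> coprime polynomials generate the unit ideal; clearing
  denominators leaves a nonzero element of \<open>\<complex>[\<lambda>]\<close>. The proof takes an element \<open>f\<close> of least degree in
  the ideal generated by \<open>p\<close> and \<open>q\<close>.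
\<close>

lemma coprime_imp_combination_const:
  fixes p q :: "complex poly poly"
  assumes "coprime p q"
  obtains u w r where "u * p + w * q = [:r:]" "r \<noteq> 0"
proof -
  define I where "I = {f. f \<noteq> 0 \<and> (\<exists>u w. f = u * p + w * q)}"
  have "p \<noteq> 0 \<or> q \<noteq> 0" using assms by auto
  then have "p \<in> I \<or> q \<in> I"
    unfolding I_def by (metis (mono_tags, lifting) add_0 add.right_neutral mem_Collect_eq mult_1 mult_zero_left)
  then have ne: "\<exists>f. f \<in> I" by blast
  define f where "f = arg_min degree (\<lambda>f. f \<in> I)"
  have f: "f \<in> I" "\<And>g. g \<in> I \<Longrightarrow> degree f \<le> degree g"
    using ne unfolding f_def by (auto intro: arg_min_natI arg_min_nat_le)
  then obtain u w where uw: "f = u * p + w * q" and f0: "f \<noteq> 0" by (auto simp: I_def)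
  \<comment> \<open>The primitive part of \<open>f\<close> divides every element of the ideal, by pseudo-division and Gauss's lemma.\<close>
  have dvd: "primitive_part f dvd g" if g: "g = u' * p + w' * q" for g u' w'
  proof -
    obtain h r where hr: "pseudo_divmod g f = (h, r)" by fastforce
    define c where "c = coeff f (degree f) ^ (Suc (degree g) - degree f)"
    have c: "c \<noteq> 0" using f0 by (simp add: c_def)
    have eq: "smult c g = f * h + r" and deg: "r = 0 \<or> degree r < degree f"
      using pseudo_divmod[OF f0 hr] by (auto simp: c_def)
    have "r = [:c:] * g - f * h" using eq by simp
    also have "\<dots> = ([:c:] * u' - h * u) * p + ([:c:] * w' - h * w) * q"
      by (simp only: g uw) (simp add: algebra_simps)
    finally have "r = 0" using deg f(2)[of r] by (force simp: I_def)
    with eq have cg: "smult c g = f * h" by simp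
    have "f = [:content f:] * primitive_part f" by simp
    then have "smult c g = primitive_part f * ([:content f:] * h)"
      unfolding cg by (metis mult.assoc mult.commute)
    then have "fract_poly (smult c g) = fract_poly (primitive_part f) * fract_poly ([:content f:] * h)"
      by (metis fract_poly_mult)
    then have "fract_poly (primitive_part f) dvd smult (to_fract c) (fract_poly g)"
      unfolding fract_poly_smult by (metis dvd_triv_left)
    then have "fract_poly (primitive_part f) dvd fract_poly g"
      using c by (simp add: dvd_smult_iff)
    then show ?thesis
      using f0 by (intro fract_poly_dvdD) auto
  qed
  have "primitive_part f dvd p" using dvd[of p 1 0] by simp
  moreover have "primitive_part f dvd q" using dvd[of q 0 1] by simp
  ultimately have "is_unit (primitive_part f)" using assms by (rule coprime_common_divisor[rotated 1])
  then obtain c where "primitive_part f = [:c:]" by (auto simp: is_unit_poly_iff)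
  then have "degree f = 0" by (metis degree_pCons_0 degree_primitive_part)
  then obtain r where "f = [:r:]" by (rule degree_eq_zeroE)
  then show ?thesis using that[of u w r] uw f0 by auto
qed

text \<open>
  A power series over \<open>\<complex>[\<lambda>]\<close> is read as a family of complex power series that depends polynomially on
  the parameter \<open>\<lambda>\<close>; this is the member at \<open>\<lambda> = z\<close>.
\<close>

definition fps_eval_coeffs :: "complex \<Rightarrow> complex poly fps \<Rightarrow> complex fps" where
  "fps_eval_coeffs z A = Abs_fps (\<lambda>n. poly (fps_nth A n) z)"

lemma fps_eval_coeffs_nth [simp]: "fps_nth (fps_eval_coeffs z A) n = poly (fps_nth A n) z"
  by (simp add: fps_eval_coeffs_def)

lemma fps_eval_coeffs_mult: "fps_eval_coeffs z (A * B) = fps_eval_coeffs z A * fps_eval_coeffs z B"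
  by (rule fps_ext) (simp add: fps_mult_nth poly_sum)

lemma fps_eval_coeffs_of_poly: "fps_eval_coeffs z (fps_of_poly p) = fps_of_poly (map_poly (\<lambda>c. poly c z) p)"
  by (rule fps_ext) (simp add: coeff_map_poly)

text \<open>
  Fatou's lemma: a rational power series with coefficients in \<open>\<complex>[\<lambda>]\<close> has a denominator whose
  constant term is a unit. Cancel the common factor of denominator and numerator. A combination of
  the two is then a nonzero \<open>r \<in> \<complex>[\<lambda>]\<close>. As the numerator is a multiple of the denominator \<open>b\<close>
  among the power series, \<open>r\<close> is the product of \<open>b\<close> and a power series \<open>e\<close>. At a root \<open>z\<close> of \<open>r\<close>
  one of the two vanishes modulo \<open>\<lambda> - z\<close>. This cannot be \<open>b\<close>, since \<open>\<lambda> - z\<close> would divide the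
  numerator as well; so the factor \<open>\<lambda> - z\<close> can be removed from both \<open>e\<close> and \<open>r\<close>, until \<open>r\<close> is a
  constant.
\<close>

lemma fatou_unit_denominator:
  fixes Q P :: "complex poly poly"
  assumes "Q \<noteq> 0" "fps_of_poly Q * \<Gamma> = fps_of_poly P"
  obtains b P' where "b dvd Q" "fps_of_poly b * \<Gamma> = fps_of_poly P'" "is_unit (coeff b 0)"
proof -
  define g where "g = gcd Q P"
  have g0: "g \<noteq> 0" using assms(1) by (simp add: g_def)
  obtain b where b: "Q = g * b" using gcd_dvd1[of Q P] unfolding g_def by (rule dvdE)
  obtain P' where P': "P = g * P'" using gcd_dvd2[of Q P] unfolding g_def by (rule dvdE)
  have "coprime b P'"
  proof (rule gcd_coprime)
    show "gcd Q P \<noteq> 0" using g0 by (simp add: g_def)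
    show "Q = b * gcd Q P" using b by (metis g_def mult.commute)
    show "P = P' * gcd Q P" using P' by (metis g_def mult.commute)
  qed
  then obtain u w r where r: "u * b + w * P' = [:r:]" "r \<noteq> 0"
    by (rule coprime_imp_combination_const)
  have b0: "b \<noteq> 0" using b assms(1) by auto
  have "fps_of_poly g * (fps_of_poly b * \<Gamma>) = fps_of_poly g * fps_of_poly P'"
    using assms(2) by (simp add: b P' fps_of_poly_mult mult.assoc)
  then have bG: "fps_of_poly b * \<Gamma> = fps_of_poly P'"
    using g0 by (metis fps_of_poly_0 fps_of_poly_eq_iff mult_cancel_left)
  have "is_unit (coeff b 0)" if "fps_of_poly b * e = fps_const r" "r \<noteq> 0" for r e
    using that
  proof (induction "degree r" arbitrary: r e)
    case 0
    have "coeff b 0 * fps_nth e 0 = r"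
      using arg_cong[OF 0(2), of "\<lambda>A. fps_nth A 0"] by simp
    moreover have "is_unit r" using 0 by (simp add: is_unit_iff_degree)
    ultimately show ?case by (metis dvd_mult_unit_iff' dvd_trans dvd_triv_left)
  next
    case (Suc d)
    obtain z where z: "poly r z = 0"
      using fundamental_theorem_of_algebra_alt[of r] Suc(2)
      by (metis degree_pCons_0 nat.distinct(1))
    then obtain r' where r': "r = [:-z, 1:] * r'" by (auto simp: poly_eq_0_iff_dvd)
    have "fps_eval_coeffs z (fps_of_poly b) * fps_eval_coeffs z e = 0"
      unfolding fps_eval_coeffs_mult[symmetric] Suc(3)
      by (rule fps_ext) (simp add: z)
    moreover have "fps_eval_coeffs z (fps_of_poly b) \<noteq> 0"
    proof
      assume zero: "fps_eval_coeffs z (fps_of_poly b) = 0"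
      have "fps_eval_coeffs z (fps_of_poly P') = 0"
        unfolding bG[symmetric] fps_eval_coeffs_mult zero by simp
      with zero have "poly (coeff b n) z = 0" "poly (coeff P' n) z = 0" for n
        by (metis fps_eval_coeffs_nth fps_of_poly_nth fps_zero_nth)+
      then have "[:[:-z, 1:]:] dvd b" "[:[:-z, 1:]:] dvd P'"
        by (auto simp: const_poly_dvd_iff poly_eq_0_iff_dvd)
      then have "is_unit [:[:-z, 1:]:]"
        using \<open>coprime b P'\<close> coprime_common_divisor by blast
      then show False by (simp add: is_unit_const_poly_iff is_unit_iff_degree)
    qed
    ultimately have "fps_eval_coeffs z e = 0" by simp
    then have e: "[:-z, 1:] dvd fps_nth e n" for n
      by (metis fps_eval_coeffs_nth fps_zero_nth poly_eq_0_iff_dvd)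
    define e' where "e' = Abs_fps (\<lambda>n. fps_nth e n div [:-z, 1:])"
    have ee': "e = fps_const [:-z, 1:] * e'"
    proof (rule fps_ext)
      fix n
      have "fps_nth e n = [:-z, 1:] * (fps_nth e n div [:-z, 1:])"
        using e by (metis dvd_mult_div_cancel)
      then show "fps_nth e n = fps_nth (fps_const [:-z, 1:] * e') n"
        by (simp only: e'_def fps_mult_left_const_nth fps_nth_Abs_fps)
    qed
    have "fps_const [:-z, 1:] * (fps_of_poly b * e') = fps_const [:-z, 1:] * fps_const r'"
      using Suc(3) by (simp add: ee' r' mult_ac)
    then have "fps_of_poly b * e' = fps_const r'"
      by (metis fps_const_eq_0_iff mult_cancel_left one_neq_zero pCons_eq_0_iff)
    moreover have r'0: "r' \<noteq> 0" using Suc(4) r' by auto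
    moreover have "d = degree r'"
      using Suc(2) degree_mult_eq[of "[:-z, 1:]" r'] r'0 unfolding r' by simp
    ultimately show ?case using Suc(1) by blast
  qed
  moreover have "fps_of_poly b * (fps_of_poly u + fps_of_poly w * \<Gamma>) = fps_const r"
  proof -
    have "fps_of_poly b * (fps_of_poly u + fps_of_poly w * \<Gamma>)
        = fps_of_poly u * fps_of_poly b + fps_of_poly w * (fps_of_poly b * \<Gamma>)"
      by (simp add: algebra_simps)
    also have "\<dots> = fps_of_poly (u * b + w * P')"
      by (simp add: bG fps_of_poly_mult fps_of_poly_add)
    finally show ?thesis by (simp add: r fps_of_poly_const)
  qed
  ultimately have "is_unit (coeff b 0)" using r(2) by blast
  moreover have "b dvd Q" by (simp add: b)
  ultimately show ?thesis using that bG by blast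
qed

section \<open>Leading forms and restriction to lines\<close>

lemma coeff_mult_bounds:
  fixes p q :: "'a::comm_semiring_0 poly"
  assumes "degree p \<le> d" "degree q \<le> e"
  shows "coeff (p * q) (d + e) = coeff p d * coeff q e"
proof -
  have "coeff (p * q) (d + e) = (\<Sum>i\<le>d + e. coeff p i * coeff q (d + e - i))"
    by (rule coeff_mult)
  also have "\<dots> = (\<Sum>i\<in>{d}. coeff p i * coeff q (d + e - i))"
  proof (rule sum.mono_neutral_right)
    show "\<forall>i\<in>{..d + e} - {d}. coeff p i * coeff q (d + e - i) = 0"
    proof
      fix i assume "i \<in> {..d + e} - {d}"
      then have "i > d \<or> d + e - i > e" by auto
      then show "coeff p i * coeff q (d + e - i) = 0"
        using assms by (auto simp: coeff_eq_0)
    qed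
  qed auto
  finally show ?thesis by simp
qed

text \<open>
  The polynomial \<open>f\<close> has degree at most \<open>d\<close> and \<open>T\<close> is its homogeneous part of degree \<open>d\<close>. What matters
  is that on every line in direction \<open>v\<close> the leading coefficient is the constant \<open>T v\<close>, whatever the
  base point \<open>y\<close>.
\<close>

definition line_expansion :: "nat \<Rightarrow> (complex ^ 'n::finite \<Rightarrow> complex) \<Rightarrow> (complex ^ 'n \<Rightarrow> complex) \<Rightarrow> bool" where
  "line_expansion d f T \<longleftrightarrow> (\<forall>v. \<exists>c :: complex ^ 'n \<Rightarrow> complex poly.
     (\<forall>k. polyfun (\<lambda>y. coeff (c y) k)) \<and>
     (\<forall>y. degree (c y) \<le> d \<and> coeff (c y) d = T v) \<and> (\<forall>y s. f (y + s *s v) = poly (c y) s))"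

lemma line_expansion_const: "line_expansion 0 (\<lambda>x. a) (\<lambda>v. a)"
  unfolding line_expansion_def
  by (intro allI exI[of _ "\<lambda>y. [:a:]"]) (auto intro: polyfun.const)

lemma line_expansion_coord:
  "line_expansion 1 (\<lambda>x :: complex ^ 'n::finite. x $ i) (\<lambda>v. v $ i)"
  unfolding line_expansion_def
proof (intro allI exI conjI)
  fix v :: "complex ^ 'n" and k
  have "(\<lambda>y. coeff [:y $ i, v $ i:] k) = (if k = 0 then (\<lambda>y. y $ i) else (\<lambda>y. coeff [:v $ i:] (k - 1)))"
    by (cases k) auto
  then show "polyfun (\<lambda>y. coeff [:y $ i, v $ i:] k)"
    by (auto intro: polyfun.intros)
qed auto

lemma line_expansion_mult:
  assumes "line_expansion d f S" "line_expansion e g T"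
  shows "line_expansion (d + e) (\<lambda>x. f x * g x) (\<lambda>v. S v * T v)"
  unfolding line_expansion_def
proof
  fix v
  obtain b c where b: "\<And>k. polyfun (\<lambda>y. coeff (b y) k)" "\<And>y. degree (b y) \<le> d"
      "\<And>y. coeff (b y) d = S v" "\<And>y s. f (y + s *s v) = poly (b y) s"
    and c: "\<And>k. polyfun (\<lambda>y. coeff (c y) k)" "\<And>y. degree (c y) \<le> e"
      "\<And>y. coeff (c y) e = T v" "\<And>y s. g (y + s *s v) = poly (c y) s"
    using assms unfolding line_expansion_def by metis
  have "degree (b y * c y) \<le> d + e" for y
    using degree_mult_le[of "b y" "c y"] b(2)[of y] c(2)[of y] by linarith
  moreover have "polyfun (\<lambda>y. coeff (b y * c y) k)" for k
    unfolding coeff_mult by (intro polyfun_sum polyfun.mult b c)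
  moreover have "coeff (b y * c y) (d + e) = S v * T v" for y
    using coeff_mult_bounds[OF b(2) c(2), of y y] b(3) c(3) by simp
  ultimately show "\<exists>c. (\<forall>k. polyfun (\<lambda>y. coeff (c y) k)) \<and>
       (\<forall>y. degree (c y) \<le> d + e \<and> coeff (c y) (d + e) = S v * T v) \<and>
       (\<forall>y s. f (y + s *s v) * g (y + s *s v) = poly (c y) s)"
    using b(4) c(4) by (intro exI[of _ "\<lambda>y. b y * c y"]) simp
qed

lemma line_expansion_prod:
  assumes "finite I" "\<And>i. i \<in> I \<Longrightarrow> line_expansion (d i) (f i) (T i)"
  shows "line_expansion (\<Sum>i\<in>I. d i) (\<lambda>x. \<Prod>i\<in>I. f i x) (\<lambda>v. \<Prod>i\<in>I. T i v)"
  using assms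
  by (induction I rule: finite_induct) (auto intro: line_expansion_const line_expansion_mult)

lemma line_expansion_power:
  assumes "line_expansion d f T"
  shows "line_expansion (k * d) (\<lambda>x. f x ^ k) (\<lambda>v. T v ^ k)"
  using assms by (induction k) (auto intro: line_expansion_const line_expansion_mult)

lemma line_expansion_sum:
  assumes "finite I" "\<And>i. i \<in> I \<Longrightarrow> line_expansion d (f i) (T i)"
  shows "line_expansion d (\<lambda>x. \<Sum>i\<in>I. f i x) (\<lambda>v. \<Sum>i\<in>I. T i v)"
  unfolding line_expansion_def
proof
  fix v
  have "\<exists>c. (\<forall>k. polyfun (\<lambda>y. coeff (c y) k)) \<and>
     (\<forall>y. degree (c y) \<le> d \<and> coeff (c y) d = T i v) \<and> (\<forall>y s. f i (y + s *s v) = poly (c y) s)"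
    if "i \<in> I" for i
    using assms(2)[OF that] unfolding line_expansion_def by blast
  then obtain c where c: "\<And>i k. i \<in> I \<Longrightarrow> polyfun (\<lambda>y. coeff (c i y) k)"
      "\<And>i y. i \<in> I \<Longrightarrow> degree (c i y) \<le> d" "\<And>i y. i \<in> I \<Longrightarrow> coeff (c i y) d = T i v"
      "\<And>i y s. i \<in> I \<Longrightarrow> f i (y + s *s v) = poly (c i y) s"
    by metis
  show "\<exists>c. (\<forall>k. polyfun (\<lambda>y. coeff (c y) k)) \<and>
       (\<forall>y. degree (c y) \<le> d \<and> coeff (c y) d = (\<Sum>i\<in>I. T i v)) \<and>
       (\<forall>y s. (\<Sum>i\<in>I. f i (y + s *s v)) = poly (c y) s)"
    by (rule exI[of _ "\<lambda>y. \<Sum>i\<in>I. c i y"])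
       (auto simp: coeff_sum poly_sum c intro!: polyfun_sum degree_sum_le \<open>finite I\<close>)
qed

lemma line_expansion_raise:
  assumes "line_expansion d f T" "d < e"
  shows "line_expansion e f (\<lambda>v. 0)"
  unfolding line_expansion_def
proof
  fix v
  obtain b where b: "\<And>k. polyfun (\<lambda>y. coeff (b y) k)" "\<And>y. degree (b y) \<le> d"
      "\<And>y s. f (y + s *s v) = poly (b y) s"
    using assms unfolding line_expansion_def by metis
  have "degree (b y) \<le> e \<and> coeff (b y) e = 0" for y
    using b(2)[of y] assms(2) by (simp add: coeff_eq_0)
  then show "\<exists>c. (\<forall>k. polyfun (\<lambda>y. coeff (c y) k)) \<and>
       (\<forall>y. degree (c y) \<le> e \<and> coeff (c y) e = 0) \<and> (\<forall>y s. f (y + s *s v) = poly (c y) s)"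
    using b by blast
qed

lemma line_expansion_monomial_at:
  "line_expansion (\<Sum>i\<in>UNIV. Poly_Mapping.lookup e i) (monomial_at e) (monomial_at e)"
  using line_expansion_prod[of UNIV "\<lambda>i. Poly_Mapping.lookup e i * 1",
      OF _ line_expansion_power[OF line_expansion_coord]]
  by (simp add: monomial_at_def[abs_def])

lemma line_expansion_exists:
  fixes a :: "complex ^ 'n::finite \<Rightarrow> complex"
  assumes "polyfun a" "a x0 \<noteq> 0"
  obtains d T v0 where "polyfun T" "T v0 \<noteq> 0" "line_expansion d a T"
proof -
  obtain p where p: "a = mpoly_eval p" using polyfun_imp_mpoly[OF assms(1)] .
  define deg where "deg e = (\<Sum>i\<in>UNIV. Poly_Mapping.lookup e i)" for e :: "'n \<Rightarrow>\<^sub>0 nat"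
  let ?K = "Poly_Mapping.keys p"
  have ne: "?K \<noteq> {}" using assms(2) by (auto simp: p mpoly_eval_def)
  define d where "d = Max (deg ` ?K)"
  have deg_le: "deg e \<le> d" if "e \<in> ?K" for e using that by (simp add: d_def)
  have "d \<in> deg ` ?K" unfolding d_def using ne by (intro Max_in) auto
  then obtain e0 where e0: "e0 \<in> ?K" "deg e0 = d" by auto
  define P where "P = (\<Sum>e\<in>?K. Poly_Mapping.single e (if deg e = d then Poly_Mapping.lookup p e else 0))"
  have "Poly_Mapping.lookup P e0 = (\<Sum>e\<in>?K. if e = e0 then Poly_Mapping.lookup p e0 else 0)"
    unfolding P_def lookup_sum by (intro sum.cong) (auto simp: lookup_single e0)
  then have "P \<noteq> 0" using e0(1) by (auto simp: in_keys_iff)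
  then obtain v0 where v0: "mpoly_eval P v0 \<noteq> 0" using mpoly_eq_0I[of P] by blast
  have le: "line_expansion d (monomial_at e) (\<lambda>v. if deg e = d then monomial_at e v else 0)"
    if "e \<in> ?K" for e
    using line_expansion_monomial_at[of e] line_expansion_raise[OF line_expansion_monomial_at[of e], of d]
      deg_le[OF that] by (cases "deg e = d") (auto simp: deg_def[symmetric])
  have "line_expansion (0 + d) (\<lambda>x. Poly_Mapping.lookup p e * monomial_at e x)
      (\<lambda>v. Poly_Mapping.lookup p e * (if deg e = d then monomial_at e v else 0))" if "e \<in> ?K" for e
    by (intro line_expansion_mult line_expansion_const le that)
  then have "line_expansion d (\<lambda>x. \<Sum>e\<in>?K. Poly_Mapping.lookup p e * monomial_at e x)
      (\<lambda>v. \<Sum>e\<in>?K. Poly_Mapping.lookup p e * (if deg e = d then monomial_at e v else 0))"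
    by (intro line_expansion_sum) auto
  moreover have "(\<lambda>v. \<Sum>e\<in>?K. Poly_Mapping.lookup p e * (if deg e = d then monomial_at e v else 0)) = mpoly_eval P"
    by (auto simp: P_def mpoly_eval_sum fun_eq_iff intro!: sum.cong)
  moreover have "(\<lambda>x. \<Sum>e\<in>?K. Poly_Mapping.lookup p e * monomial_at e x) = a"
    by (simp add: p mpoly_eval_superset[OF finite_keys subset_refl, abs_def])
  ultimately have "line_expansion d a (mpoly_eval P)" by simp
  then show ?thesis using that[OF polyfun_mpoly_eval v0] by blast
qed

lemma polyfun_mult_nonzero:
  assumes "polyfun f" "polyfun g" "f x \<noteq> 0" "g y \<noteq> 0"
  obtains z where "f z * g z \<noteq> 0"
proof -
  obtain P where P: "\<And>t. f (x + t *s (y - x)) = poly P t" using polyfun_line[OF assms(1)] by blast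
  obtain Q where Q: "\<And>t. g (x + t *s (y - x)) = poly Q t" using polyfun_line[OF assms(2)] by blast
  have "P \<noteq> 0" using P[of 0] assms(3) by auto
  moreover have "Q \<noteq> 0" using Q[of 1] assms(4) by auto
  ultimately have "P * Q \<noteq> 0" by simp
  then obtain t where "poly (P * Q) t \<noteq> 0" using poly_all_0_iff_0 by blast
  then show ?thesis using that[of "x + t *s (y - x)"] P Q by simp
qed

lemma polyfun_prod_nonzero:
  fixes f :: "'i \<Rightarrow> complex ^ 'n::finite \<Rightarrow> complex"
  assumes "finite I" "\<And>i. i \<in> I \<Longrightarrow> polyfun (f i)" "\<And>i. i \<in> I \<Longrightarrow> \<exists>x. f i x \<noteq> 0"
  shows "\<exists>x. (\<Prod>i\<in>I. f i x) \<noteq> 0"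
  using assms
proof (induction I rule: finite_induct)
  case (insert i I)
  then obtain x y where "f i x \<noteq> 0" "(\<Prod>i\<in>I. f i y) \<noteq> 0" by fastforce
  moreover have "polyfun (f i)" "polyfun (\<lambda>x. \<Prod>i\<in>I. f i x)"
    using insert.prems by (auto intro: polyfun_prod)
  ultimately obtain z where "f i z * (\<Prod>i\<in>I. f i z) \<noteq> 0"
    using polyfun_mult_nonzero[of "f i" "\<lambda>x. \<Prod>i\<in>I. f i x"] by blast
  then show ?case using insert.hyps by auto
qed auto

section \<open>Algebraic dependence\<close>

lemma sum_fun_apply: "(\<Sum>a\<in>A. f a) x = (\<Sum>a\<in>A. f a x)"
  by (induction A rule: infinite_finite_induct) auto

interpretation fun_space: vector_space "\<lambda>(c::complex) (f :: 'b \<Rightarrow> complex) x. c * f x"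
  by unfold_locales (auto simp: fun_eq_iff algebra_simps)

definition monomial_fun :: "('n::finite \<Rightarrow> nat) \<Rightarrow> complex ^ 'n \<Rightarrow> complex" where
  "monomial_fun e x = (\<Prod>i\<in>UNIV. x $ i ^ e i)"

definition exponents :: "nat \<Rightarrow> ('n::finite \<Rightarrow> nat) set" where
  "exponents K = {e. \<forall>i. e i \<le> K}"

lemma exponents_eq_PiE: "exponents K = (UNIV \<rightarrow>\<^sub>E {..K})"
  by (auto simp: exponents_def PiE_def Pi_def)

lemma finite_exponents: "finite (exponents K :: ('n::finite \<Rightarrow> nat) set)"
  unfolding exponents_eq_PiE by (intro finite_PiE) auto

lemma card_exponents: "card (exponents K :: ('n::finite \<Rightarrow> nat) set) = Suc K ^ CARD('n)"
  unfolding exponents_eq_PiE by (subst card_PiE) auto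

text \<open>The polynomial functions of degree at most \<open>K\<close> in each variable.\<close>

definition box_space :: "nat \<Rightarrow> (complex ^ 'n::finite \<Rightarrow> complex) set" where
  "box_space K = fun_space.span (monomial_fun ` exponents K)"

lemma box_space_mono: "K \<le> L \<Longrightarrow> box_space K \<subseteq> box_space L"
  unfolding box_space_def by (intro fun_space.span_mono image_mono) (auto simp: exponents_def intro: order_trans)

lemma monomial_fun_add: "monomial_fun (\<lambda>i. e i + e' i) x = monomial_fun e x * monomial_fun e' x"
  by (simp add: monomial_fun_def power_add prod.distrib)

lemma box_space_mult:
  assumes "f \<in> box_space K" "g \<in> box_space L"
  shows "(\<lambda>x. f x * g x) \<in> box_space (K + L)"
  using assms(1) unfolding box_space_def
proof (induction rule: fun_space.span_induct_alt)
  case base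
  then show ?case using fun_space.span_zero by (simp add: zero_fun_def)
next
  case (step c f h)
  then obtain e where e: "e \<in> exponents K" "f = monomial_fun e" by blast
  have "(\<lambda>x. f x * g x) \<in> fun_space.span (monomial_fun ` exponents (K + L))"
    using assms(2) unfolding box_space_def
  proof (induction rule: fun_space.span_induct_alt)
    case base
    then show ?case using fun_space.span_zero by (simp add: zero_fun_def)
  next
    case (step c' f' h')
    then obtain e' where e': "e' \<in> exponents L" "f' = monomial_fun e'" by blast
    have "(\<lambda>x. f x * f' x) = monomial_fun (\<lambda>i. e i + e' i)"
      by (simp add: e e' monomial_fun_add fun_eq_iff)
    moreover have "(\<lambda>i. e i + e' i) \<in> exponents (K + L)"
      using e(1) e'(1) by (auto simp: exponents_def intro: add_mono)
    ultimately have "(\<lambda>x. f x * f' x) \<in> fun_space.span (monomial_fun ` exponents (K + L))"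
      by (metis fun_space.span_base imageI)
    from fun_space.span_add[OF fun_space.span_scale[OF this, of c'] step(2)]
    show ?case by (simp add: plus_fun_def algebra_simps)
  qed
  from fun_space.span_add[OF fun_space.span_scale[OF this, of c] step(2)]
  show ?case by (simp add: plus_fun_def algebra_simps)
qed

lemma box_space_const: "(\<lambda>x. c) \<in> box_space 0"
proof -
  have "monomial_fun (\<lambda>i. 0) \<in> fun_space.span (monomial_fun ` exponents 0)"
    by (intro fun_space.span_base imageI) (auto simp: exponents_def)
  from fun_space.span_scale[OF this, of c] show ?thesis
    by (simp add: box_space_def monomial_fun_def)
qed

lemma box_space_power:
  assumes "f \<in> box_space K"
  shows "(\<lambda>x. f x ^ m) \<in> box_space (m * K)"
  using assms by (induction m) (auto intro: box_space_const box_space_mult)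

lemma box_space_prod:
  assumes "finite I" "\<And>i. i \<in> I \<Longrightarrow> f i \<in> box_space (K i)"
  shows "(\<lambda>x. \<Prod>i\<in>I. f i x) \<in> box_space (\<Sum>i\<in>I. K i)"
  using assms by (induction I rule: finite_induct) (auto intro: box_space_const box_space_mult)

lemma polyfun_imp_box_space:
  fixes f :: "complex ^ 'n::finite \<Rightarrow> complex"
  assumes "polyfun f"
  shows "\<exists>K. f \<in> box_space K"
  using assms
proof induction
  case (const c)
  then show ?case using box_space_const by blast
next
  case (coord i)
  have "(\<lambda>x::complex ^ 'n. x $ i) = monomial_fun (\<lambda>j. if j = i then 1 else 0)"
    by (auto simp: monomial_fun_def fun_eq_iff if_distrib[of "\<lambda>k. _ ^ k"] cong: if_cong)
  moreover have "monomial_fun (\<lambda>j::'n. if j = i then 1 else 0) \<in> box_space 1"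
    unfolding box_space_def by (intro fun_space.span_base imageI) (auto simp: exponents_def)
  ultimately show ?case by metis
next
  case (add f g)
  then obtain K L where KL: "f \<in> box_space K" "g \<in> box_space L" by blast
  have "f \<in> box_space (K + L)" "g \<in> box_space (K + L)"
    using KL box_space_mono[of K "K + L"] box_space_mono[of L "K + L"] by auto
  then have "f + g \<in> box_space (K + L)" unfolding box_space_def by (rule fun_space.span_add)
  then show ?case by (auto simp: plus_fun_def)
next
  case (mult f g)
  then show ?case using box_space_mult by blast
qed

text \<open>
  Any \<open>n + 1\<close> polynomials in \<open>n\<close> variables are algebraically dependent: there are \<open>(K + 1)^(n + 1)\<close>
  products of powers up to \<open>K\<close>, and they lie in a space whose dimension is of order \<open>K^n\<close> only.
\<close>

lemma algebraic_dependence: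
  fixes F :: "complex ^ 'n::finite \<Rightarrow> complex ^ 'n" and g :: "complex ^ 'n \<Rightarrow> complex"
  assumes "\<And>i. polyfun (\<lambda>x. F x $ i)" "polyfun g"
  obtains K and c :: "('n \<Rightarrow> nat) \<Rightarrow> nat \<Rightarrow> complex" and e0 j0 where
    "e0 \<in> exponents K" "j0 \<le> K" "c e0 j0 \<noteq> 0"
    "\<And>x. (\<Sum>j\<le>K. (\<Sum>e\<in>exponents K. c e j * monomial_fun e (F x)) * g x ^ j) = 0"
proof -
  have "\<forall>i. \<exists>K. (\<lambda>x. F x $ i) \<in> box_space K" using assms(1) polyfun_imp_box_space by blast
  then obtain L where L: "\<And>i. (\<lambda>x. F x $ i) \<in> box_space (L i)" by metis
  obtain M where M: "g \<in> box_space M" using assms(2) polyfun_imp_box_space by blast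
  define B where "B = Suc ((\<Sum>i\<in>UNIV. L i) + M)"
  \<comment> \<open>With this choice \<open>(K B + 1)^n \<le> B^n (K + 1)^n = K (K + 1)^n < (K + 1)^(n + 1)\<close>.\<close>
  define K where "K = B ^ CARD('n)"
  define f where "f = (\<lambda>(e, j) x. monomial_fun e (F x) * g x ^ j)"
  define I where "I = (exponents K :: ('n \<Rightarrow> nat) set) \<times> {..K}"
  have finI: "finite I" by (simp add: I_def finite_exponents)
  have "f (e, j) \<in> box_space (K * B)" if "(e, j) \<in> I" for e j
  proof -
    have "(\<lambda>x. (\<Prod>i\<in>UNIV. F x $ i ^ e i) * g x ^ j) \<in> box_space ((\<Sum>i\<in>UNIV. e i * L i) + j * M)"
      by (intro box_space_mult box_space_prod box_space_power L M) auto
    moreover have "(\<Sum>i\<in>UNIV. e i * L i) + j * M \<le> K * B"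
    proof -
      have "(\<Sum>i\<in>UNIV. e i * L i) \<le> (\<Sum>i\<in>UNIV. K * L i)"
        using that by (intro sum_mono mult_right_mono) (auto simp: I_def exponents_def)
      moreover have "j * M \<le> K * M" using that by (auto simp: I_def)
      ultimately have "(\<Sum>i\<in>UNIV. e i * L i) + j * M \<le> K * ((\<Sum>i\<in>UNIV. L i) + M)"
        unfolding sum_distrib_left distrib_left by (rule add_mono)
      also have "\<dots> \<le> K * B" by (simp add: B_def)
      finally show ?thesis .
    qed
    ultimately show ?thesis using box_space_mono by (auto simp: f_def monomial_fun_def)
  qed
  then have sub: "f ` I \<subseteq> fun_space.span (monomial_fun ` exponents (K * B))"
    by (auto simp: box_space_def)
  have less: "Suc (K * B) ^ CARD('n) < card I"
  proof -
    have "Suc (K * B) \<le> B * Suc K" by (simp add: B_def)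
    then have "Suc (K * B) ^ CARD('n) \<le> (B * Suc K) ^ CARD('n)" by (rule power_mono) simp
    also have "\<dots> = K * Suc K ^ CARD('n)" by (simp only: power_mult_distrib K_def)
    also have "\<dots> < Suc K * Suc K ^ CARD('n)" by (intro mult_strict_right_mono) auto
    also have "\<dots> = card I" by (simp add: I_def card_cartesian_product card_exponents mult.commute)
    finally show ?thesis .
  qed
  have "\<exists>c ij. ij \<in> I \<and> c ij \<noteq> 0 \<and> (\<forall>x. (\<Sum>ij\<in>I. c ij * f ij x) = 0)"
  proof (cases "inj_on f I")
    case False
    then obtain a b where ab: "a \<in> I" "b \<in> I" "a \<noteq> b" "f a = f b" by (auto simp: inj_on_def)
    define c where "c = (\<lambda>ij. if ij = a then 1 else if ij = b then - 1 else (0::complex))"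
    have "(\<Sum>ij\<in>I. c ij * f ij x) = 0" for x
    proof -
      have "(\<Sum>ij\<in>I. c ij * f ij x) = (\<Sum>ij\<in>{a, b}. c ij * f ij x)"
        using ab finI by (intro sum.mono_neutral_right) (auto simp: c_def)
      then show ?thesis using ab by (simp add: c_def)
    qed
    then show ?thesis using ab(1) by (intro exI[of _ c] exI[of _ a]) (auto simp: c_def)
  next
    case True
    have "fun_space.dependent (f ` I)"
    proof (rule ccontr)
      assume "\<not> fun_space.dependent (f ` I)"
      then have "card (f ` I) \<le> card (monomial_fun ` (exponents (K * B) :: ('n \<Rightarrow> nat) set))"
        using fun_space.independent_span_bound[OF _ _ sub] finite_exponents by blast
      also have "\<dots> \<le> Suc (K * B) ^ CARD('n)"
        using card_image_le[OF finite_exponents] by (metis card_exponents)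
      finally show False using less True by (simp add: card_image)
    qed
    then obtain u h where u: "(\<Sum>h\<in>f ` I. (\<lambda>x. u h * h x)) = 0" "h \<in> f ` I" "u h \<noteq> 0"
      using fun_space.dependent_finite[of "f ` I"] finI by blast
    have "(\<Sum>ij\<in>I. u (f ij) * f ij x) = 0" for x
    proof -
      have "(\<Sum>h\<in>f ` I. (\<lambda>x. u h * h x)) x = (\<Sum>h\<in>f ` I. u h * h x)"
        by (rule sum_fun_apply)
      then have "(\<Sum>h\<in>f ` I. u h * h x) = 0" using u(1) by simp
      then show ?thesis by (simp add: sum.reindex[OF True])
    qed
    then show ?thesis using u(2,3) by (intro exI[of _ "\<lambda>ij. u (f ij)"]) auto
  qed
  then obtain c e0 j0 where c: "(e0, j0) \<in> I" "c (e0, j0) \<noteq> 0" "\<And>x. (\<Sum>ij\<in>I. c ij * f ij x) = 0"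
    by auto
  have "(\<Sum>j\<le>K. (\<Sum>e\<in>exponents K. c (e, j) * monomial_fun e (F x)) * g x ^ j) = 0" for x
  proof -
    have "(\<Sum>ij\<in>I. c ij * f ij x) = (\<Sum>e\<in>exponents K. \<Sum>j\<le>K. c (e, j) * f (e, j) x)"
      unfolding I_def by (simp add: sum.cartesian_product case_prod_unfold)
    also have "\<dots> = (\<Sum>j\<le>K. (\<Sum>e\<in>exponents K. c (e, j) * monomial_fun e (F x)) * g x ^ j)"
      by (subst sum.swap) (simp add: f_def sum_distrib_left sum_distrib_right mult_ac)
    finally show ?thesis using c(3) by simp
  qed
  then show ?thesis using that[of e0 K j0 "\<lambda>e j. c (e, j)"] c(1,2) by (auto simp: I_def)
qed

section \<open>The inverse of an injective polynomial map with constant Jacobian determinant\<close>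

text \<open>
  Multiplied by a power of the leading coefficient, the equation becomes a monic one for
  \<open>\<alpha> d * t\<close>, so this product is bounded by the coefficients although \<open>t\<close> itself need not be.
\<close>

lemma leading_coeff_root_bound:
  fixes \<alpha> :: "nat \<Rightarrow> complex"
  assumes "(\<Sum>j\<le>d. \<alpha> j * t ^ j) = 0" "d > 0"
  shows "norm (\<alpha> d * t) \<le> 1 + (\<Sum>j<d. norm (\<alpha> j) * norm (\<alpha> d) ^ (d - 1 - j))"
proof (cases "norm (\<alpha> d * t) \<le> 1")
  case True
  then show ?thesis by (rule order_trans) (simp add: sum_nonneg)
next
  case False
  define w where "w = \<alpha> d * t"
  have w: "norm w > 1" using False by (simp add: w_def)
  have "\<alpha> d ^ (d - 1) * (\<Sum>j\<le>d. \<alpha> j * t ^ j) = 0" using assms(1) by simp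
  also have "(\<Sum>j\<le>d. \<alpha> j * t ^ j) = (\<Sum>j<d. \<alpha> j * t ^ j) + \<alpha> d * t ^ d"
    by (simp flip: lessThan_Suc_atMost)
  finally have top: "\<alpha> d ^ (d - 1) * (\<alpha> d * t ^ d) = - (\<Sum>j<d. \<alpha> d ^ (d - 1) * (\<alpha> j * t ^ j))"
    by (simp add: distrib_left sum_distrib_left eq_neg_iff_add_eq_0 add.commute)
  have wd: "\<alpha> d ^ (d - 1) * (\<alpha> d * t ^ d) = w ^ d"
    using assms(2) by (cases d) (auto simp: w_def power_mult_distrib)
  have wj: "\<alpha> d ^ (d - 1) * (\<alpha> j * t ^ j) = \<alpha> j * \<alpha> d ^ (d - 1 - j) * w ^ j" if "j < d" for j
  proof -
    have "d - 1 = (d - 1 - j) + j" using that by simp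
    then have "\<alpha> d ^ (d - 1) = \<alpha> d ^ (d - 1 - j) * \<alpha> d ^ j" by (metis power_add)
    then show ?thesis by (simp add: w_def power_mult_distrib)
  qed
  have "w ^ d = - (\<Sum>j<d. \<alpha> j * \<alpha> d ^ (d - 1 - j) * w ^ j)"
    unfolding wd[symmetric] top by (intro arg_cong[where f = uminus] sum.cong refl wj) auto
  then have "norm w ^ d = norm (\<Sum>j<d. \<alpha> j * \<alpha> d ^ (d - 1 - j) * w ^ j)"
    by (metis norm_minus_cancel norm_power)
  also have "\<dots> \<le> (\<Sum>j<d. norm (\<alpha> j) * norm (\<alpha> d) ^ (d - 1 - j) * norm w ^ j)"
    by (rule order_trans[OF norm_sum]) (simp add: norm_mult norm_power)
  also have "\<dots> \<le> (\<Sum>j<d. norm (\<alpha> j) * norm (\<alpha> d) ^ (d - 1 - j) * norm w ^ (d - 1))"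
    using w by (intro sum_mono mult_left_mono power_increasing) auto
  also have "\<dots> = (\<Sum>j<d. norm (\<alpha> j) * norm (\<alpha> d) ^ (d - 1 - j)) * norm w ^ (d - 1)"
    by (simp add: sum_distrib_right)
  finally have "norm w * norm w ^ (d - 1) \<le> (\<Sum>j<d. norm (\<alpha> j) * norm (\<alpha> d) ^ (d - 1 - j)) * norm w ^ (d - 1)"
    using assms(2) by (cases d) auto
  then have "norm w \<le> (\<Sum>j<d. norm (\<alpha> j) * norm (\<alpha> d) ^ (d - 1 - j))"
    by (rule mult_right_le_imp_le) (use w in \<open>intro zero_less_power, linarith\<close>)
  then show ?thesis by (simp add: w_def)
qed

lemma matrix_vector_mult_scale: "A *v (s *s v) = s *s (A *v v)" for A :: "complex ^ 'n::finite ^ 'm::finite"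
  by (simp add: matrix_vector_mult_def vec_eq_iff sum_distrib_left mult_ac)

lemma bounded_linear_matrix_vector_mult: "bounded_linear ((*v) A)" for A :: "complex ^ 'n::finite ^ 'm::finite"
proof -
  have "linear ((*v) A)"
    by (rule linearI) (simp_all add: matrix_vector_mult_def vec_eq_iff sum.distrib distrib_left
        scaleR_sum_right)
  then show ?thesis by (simp add: linear_conv_bounded_linear)
qed

lemma has_derivative_line:
  fixes v :: "complex ^ 'n::finite"
  shows "((\<lambda>s. y + s *s v) has_derivative (\<lambda>s. s *s v)) (at s)"
proof -
  have "linear (\<lambda>s. s *s v)"
    by (rule linearI) (simp_all add: vec_eq_iff algebra_simps)
  then have "bounded_linear (\<lambda>s. s *s v)" by (simp add: linear_conv_bounded_linear)
  then show ?thesis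
    using has_derivative_add[OF has_derivative_const bounded_linear_imp_has_derivative] by fastforce
qed

text \<open>
  The Jacobian matrix \<open>J\<close> of \<open>f\<close> has constant nonzero determinant and \<open>f\<close> is injective. The locale
  collects the proof that \<open>f\<close> is surjective and that its inverse \<open>g\<close> is polynomial. Until then \<open>g\<close>
  is meaningful only on the image \<open>U\<close> of \<open>f\<close>, which is open by invariance of domain.
\<close>

locale unimodular_injection =
  fixes f :: "complex ^ 'n::finite \<Rightarrow> complex ^ 'n" and J :: "complex ^ 'n \<Rightarrow> complex ^ 'n ^ 'n"
    and \<kappa> :: complex
  assumes polyfun_f: "\<And>i. polyfun (\<lambda>x. f x $ i)"
    and polyfun_J: "\<And>i j. polyfun (\<lambda>x. J x $ i $ j)"
    and has_derivative_f: "\<And>x. (f has_derivative (\<lambda>h. J x *v h)) (at x)"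
    and det_J: "\<And>x. det (J x) = \<kappa>"
    and \<kappa>_nonzero: "\<kappa> \<noteq> 0"
    and inj_f: "inj f"
begin

definition g :: "complex ^ 'n \<Rightarrow> complex ^ 'n" where "g = inv f"

abbreviation U :: "(complex ^ 'n) set" where "U \<equiv> range f"

lemma g_f [simp]: "g (f x) = x"
  unfolding g_def using inj_f by simp

lemma f_g: "y \<in> U \<Longrightarrow> f (g y) = y"
  unfolding g_def by (rule f_inv_into_f)

lemma continuous_on_f: "continuous_on S f"
  using has_derivative_f has_derivative_continuous continuous_at_imp_continuous_on by blast

lemma open_U: "open U"
  using invariance_of_domain[OF continuous_on_f open_UNIV inj_f] .

lemma continuous_on_g: "continuous_on U g"
  by (rule continuous_on_inverse_open) (auto intro: continuous_on_f)

lemma isCont_g: "y \<in> U \<Longrightarrow> isCont g y"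
  using continuous_on_g open_U continuous_on_eq_continuous_at by blast

text \<open>Cramer's rule makes the inverse Jacobian, and with it the derivative of \<open>g\<close>, polynomial in \<open>x = g y\<close>.\<close>

definition velocity :: "complex ^ 'n \<Rightarrow> complex ^ 'n \<Rightarrow> complex ^ 'n" where
  "velocity v x = (\<chi> k. det (\<chi> i j. if j = k then v $ i else J x $ i $ j) / \<kappa>)"

lemma velocity_iff: "J x *v z = v \<longleftrightarrow> z = velocity v x"
  using cramer[of "J x" z v] det_J \<kappa>_nonzero by (simp add: velocity_def)

lemma velocity_scale: "velocity (s *s v) x = s *s velocity v x"
proof -
  have "J x *v (s *s velocity v x) = s *s v"
    unfolding matrix_vector_mult_scale using velocity_iff by metis
  then show ?thesis using velocity_iff by metis
qed

lemma bounded_linear_velocity: "bounded_linear (\<lambda>v. velocity v x)"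
proof -
  interpret Jx: bounded_linear "(*v) (J x)" by (rule bounded_linear_matrix_vector_mult)
  have *: "J x *v velocity v x = v" for v using velocity_iff by metis
  have "linear (\<lambda>v. velocity v x)"
  proof (rule linearI)
    fix v w r
    have "J x *v (velocity v x + velocity w x) = v + w" by (simp only: Jx.add *)
    then show "velocity (v + w) x = velocity v x + velocity w x" using velocity_iff by metis
    have "J x *v (r *\<^sub>R velocity v x) = r *\<^sub>R v" by (simp only: Jx.scaleR *)
    then show "velocity (r *\<^sub>R v) x = r *\<^sub>R velocity v x" using velocity_iff by metis
  qed
  then show ?thesis by (simp add: linear_conv_bounded_linear)
qed

lemma polyfun_velocity: "polyfun (\<lambda>x. velocity v x $ k)"
proof -
  have *: "polyfun (\<lambda>x. if j = k then v $ i else J x $ i $ j)" for i j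
    by (cases "j = k") (simp_all add: polyfun.const polyfun_J)
  have "polyfun (\<lambda>x. (\<Sum>p | p permutes UNIV. of_int (sign p) *
      (\<Prod>i\<in>UNIV. if p i = k then v $ i else J x $ i $ p i)) * inverse \<kappa>)"
    by (intro polyfun.mult polyfun_sum polyfun_prod polyfun.const *)
  then show ?thesis by (simp add: velocity_def det_def divide_inverse)
qed

lemma has_derivative_g:
  assumes "y \<in> U"
  shows "(g has_derivative (\<lambda>v. velocity v (g y))) (at y)"
proof (rule has_derivative_inverse_basic[OF has_derivative_f bounded_linear_velocity _ _ open_U assms f_g])
  show "(\<lambda>v. velocity v (g y)) \<circ> (\<lambda>h. J (g y) *v h) = id"
  proof
    fix h
    show "((\<lambda>v. velocity v (g y)) \<circ> (\<lambda>h. J (g y) *v h)) h = id h"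
      using velocity_iff[of "g y" h "J (g y) *v h"] by simp
  qed
qed (use isCont_g assms in auto)

lemma has_field_derivative_g_line:
  assumes "y + s *s v \<in> U"
  shows "((\<lambda>s. g (y + s *s v) $ k) has_field_derivative velocity v (g (y + s *s v)) $ k) (at s)"
proof -
  let ?z = "y + s *s v"
  have "((\<lambda>s. y + s *s v) has_derivative (\<lambda>s. s *s v)) (at s)"
    by (rule has_derivative_line)
  from has_derivative_compose[OF this has_derivative_g[OF assms]]
  have "((\<lambda>s. g (y + s *s v)) has_derivative (\<lambda>s. s *s velocity v (g ?z))) (at s)"
    by (simp add: velocity_scale)
  then have "((\<lambda>s. g (y + s *s v) $ k) has_derivative (\<lambda>s. (s *s velocity v (g ?z)) $ k)) (at s)"
    by (rule bounded_linear.has_derivative[OF bounded_linear_vec_nth])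
  then show ?thesis
    unfolding has_field_derivative_def by (elim has_derivative_eq_rhs) (simp add: fun_eq_iff)
qed

text \<open>
  Moving \<open>y = f x\<close> in direction \<open>v\<close> moves \<open>x\<close> along a polynomial vector field. Differentiation along
  the line therefore becomes a derivation of the polynomial ring in \<open>x\<close>.
\<close>

lemma polyfun_derivation_exists:
  assumes "polyfun p"
  shows "\<exists>p'. polyfun p' \<and> (\<forall>y s. y + s *s v \<in> U \<longrightarrow>
     ((\<lambda>s. p (g (y + s *s v))) has_field_derivative p' (g (y + s *s v))) (at s))"
  using assms
proof induction
  case (const c)
  show ?case by (rule exI[of _ "\<lambda>x. 0"]) (auto intro: polyfun.const)
next
  case (coord i)
  show ?case
    by (rule exI[of _ "\<lambda>x. velocity v x $ i"]) (auto intro: polyfun_velocity has_field_derivative_g_line)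
next
  case (add p q)
  then obtain p' q' where "polyfun p'" "polyfun q'"
    "\<And>y s. y + s *s v \<in> U \<Longrightarrow> ((\<lambda>s. p (g (y + s *s v))) has_field_derivative p' (g (y + s *s v))) (at s)"
    "\<And>y s. y + s *s v \<in> U \<Longrightarrow> ((\<lambda>s. q (g (y + s *s v))) has_field_derivative q' (g (y + s *s v))) (at s)"
    by blast
  note pq = this
  show ?case
    using polyfun.add[OF pq(1,2)] DERIV_add[OF pq(3,4)] by (intro exI[of _ "\<lambda>x. p' x + q' x"]) auto
next
  case (mult p q)
  then obtain p' q' where pq: "polyfun p'" "polyfun q'"
    "\<And>y s. y + s *s v \<in> U \<Longrightarrow> ((\<lambda>s. p (g (y + s *s v))) has_field_derivative p' (g (y + s *s v))) (at s)"
    "\<And>y s. y + s *s v \<in> U \<Longrightarrow> ((\<lambda>s. q (g (y + s *s v))) has_field_derivative q' (g (y + s *s v))) (at s)"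
    by blast
  have "polyfun (\<lambda>x. p' x * q x + q' x * p x)"
    by (intro polyfun.add polyfun.mult pq mult.hyps)
  then show ?case
    using DERIV_mult[OF pq(3,4)] by (intro exI[of _ "\<lambda>x. p' x * q x + q' x * p x"]) auto
qed

text \<open>
  The relation determines the values on the image of \<open>g\<close>, which is the whole space; the choice
  only selects the polynomial function that satisfies it.
\<close>

definition derivation :: "complex ^ 'n \<Rightarrow> (complex ^ 'n \<Rightarrow> complex) \<Rightarrow> complex ^ 'n \<Rightarrow> complex" where
  "derivation v p = (SOME p'. polyfun p' \<and> (\<forall>y s. y + s *s v \<in> U \<longrightarrow>
     ((\<lambda>s. p (g (y + s *s v))) has_field_derivative p' (g (y + s *s v))) (at s)))"

lemma
  assumes "polyfun p"
  shows polyfun_derivation: "polyfun (derivation v p)"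
    and has_field_derivative_derivation: "y + s *s v \<in> U \<Longrightarrow>
      ((\<lambda>s. p (g (y + s *s v))) has_field_derivative derivation v p (g (y + s *s v))) (at s)"
  using someI_ex[OF polyfun_derivation_exists[OF assms, of v]] unfolding derivation_def by auto

lemma polyfun_derivation_iterate: "polyfun p \<Longrightarrow> polyfun ((derivation v ^^ k) p)"
  by (induction k) (auto intro: polyfun_derivation)

lemma open_line_domain: "open {s. y + s *s v \<in> U}"
proof -
  have "continuous_on UNIV (\<lambda>s. y + s *s v)"
    by (intro continuous_at_imp_continuous_on ballI has_derivative_continuous[OF has_derivative_line])
  from open_vimage[OF open_U this] show ?thesis by (simp add: vimage_def)
qed

lemma higher_deriv_g_line:
  assumes "polyfun p" "y + s *s v \<in> U"
  shows "(deriv ^^ k) (\<lambda>s. p (g (y + s *s v))) s = (derivation v ^^ k) p (g (y + s *s v))"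
  using assms(2)
proof (induction k arbitrary: s)
  case (Suc k)
  have "((\<lambda>s. (derivation v ^^ k) p (g (y + s *s v))) has_field_derivative
      derivation v ((derivation v ^^ k) p) (g (y + s *s v))) (at s)"
    by (rule has_field_derivative_derivation[OF polyfun_derivation_iterate[OF assms(1)] Suc.prems])
  then have "((deriv ^^ k) (\<lambda>s. p (g (y + s *s v))) has_field_derivative
      derivation v ((derivation v ^^ k) p) (g (y + s *s v))) (at s)"
    by (rule has_field_derivative_transform_within_open[OF _ open_line_domain[of y v]])
       (use Suc in auto)
  then show ?case by (simp add: DERIV_imp_deriv)
qed simp

text \<open>
  The Taylor series at \<open>s = 0\<close> of the inverse along the line \<open>f x + s v\<close>. Iterating the derivation
  shows that its coefficients are polynomial in \<open>x\<close>, so that Fatou's lemma applies when \<open>x\<close> runs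
  through a line.
\<close>

definition taylor_g :: "complex ^ 'n \<Rightarrow> 'n \<Rightarrow> complex ^ 'n \<Rightarrow> complex fps" where
  "taylor_g v i x = Abs_fps (\<lambda>k. (derivation v ^^ k) (\<lambda>x. x $ i) x / fact k)"

lemma holomorphic_g_line: "(\<lambda>s. g (y + s *s v) $ i) holomorphic_on {s. y + s *s v \<in> U}"
  using has_field_derivative_g_line by (subst holomorphic_on_open[OF open_line_domain]) blast

lemma has_fps_expansion_g_line: "(\<lambda>s. g (f x + s *s v) $ i) has_fps_expansion taylor_g v i x"
proof -
  have "(\<lambda>s. g (f x + s *s v) $ i) has_fps_expansion fps_expansion (\<lambda>s. g (f x + s *s v) $ i) 0"
    by (rule has_fps_expansion_fps_expansion[OF open_line_domain _ holomorphic_g_line]) simp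
  moreover have "fps_expansion (\<lambda>s. g (f x + s *s v) $ i) 0 = taylor_g v i x"
    using higher_deriv_g_line[OF polyfun.coord[of i], of "f x" 0 v]
    by (simp add: fps_expansion_def taylor_g_def)
  ultimately show ?thesis by simp
qed

text \<open>
  By algebraic dependence \<open>x\<^sub>i\<close> is a root of a polynomial whose coefficients are polynomials in
  \<open>f x\<close>. Its leading coefficient serves as \<open>a\<close>. The relation involves \<open>x\<^sub>i\<close>, because a relation
  between the components of \<open>f\<close> alone would vanish on the open set \<open>U\<close>.
\<close>

lemma coordinate_growth:
  "\<exists>a. polyfun a \<and> (\<exists>y. a y \<noteq> 0) \<and> (\<exists>h. poly_growth h \<and> (\<forall>x. norm (a (f x) * x $ i) \<le> h (f x)))"
proof -
  obtain K and c :: "('n \<Rightarrow> nat) \<Rightarrow> nat \<Rightarrow> complex" and e0 j0 where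
    c: "e0 \<in> exponents K" "j0 \<le> K" "c e0 j0 \<noteq> 0"
    "\<And>x. (\<Sum>j\<le>K. (\<Sum>e\<in>exponents K. c e j * monomial_fun e (f x)) * x $ i ^ j) = 0"
  proof (rule algebraic_dependence[where F = f and g = "\<lambda>x. x $ i", OF polyfun_f polyfun.coord])
    fix K c e0 j0
    assume "e0 \<in> exponents K" "j0 \<le> K" "c e0 j0 \<noteq> 0"
      "\<And>x. (\<Sum>j\<le>K. (\<Sum>e\<in>exponents K. c e j * monomial_fun e (f x)) * x $ i ^ j) = 0"
    then show thesis by (rule that)
  qed
  define A where "A j y = (\<Sum>e\<in>exponents K. c e j * monomial_fun e y)" for j and y :: "complex ^ 'n"
  have polyA: "polyfun (A j)" for j
    unfolding A_def[abs_def] monomial_fun_def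
    by (intro polyfun_sum polyfun_cmult polyfun_prod polyfun_power polyfun.coord)
  have "\<exists>y. A j0 y \<noteq> 0"
  proof (rule ccontr)
    assume "\<not> (\<exists>y. A j0 y \<noteq> 0)"
    then have "A j0 (\<chi> i. x i) = 0" for x by blast
    then have "(\<Sum>e\<in>exponents K. c e j0 * (\<Prod>i\<in>UNIV. x i ^ e i)) = 0" for x
      by (simp add: A_def monomial_fun_def)
    note van = this
    have "c e0 j0 = 0"
    proof (rule monomials_independent[of UNIV "exponents K" "\<lambda>e. c e j0"])
      show "e = e'" if "\<forall>i\<in>UNIV. e i = e' i" for e e' :: "'n \<Rightarrow> nat"
        using that by (simp add: fun_eq_iff)
    qed (use c(1) van finite_exponents in auto)
    then show False using c(3) by simp
  qed
  then have j0: "j0 \<in> {j. j \<le> K \<and> (\<exists>y. A j y \<noteq> 0)}" using c(2) by simp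
  define d where "d = Max {j. j \<le> K \<and> (\<exists>y. A j y \<noteq> 0)}"
  have fin: "finite {j. j \<le> K \<and> (\<exists>y. A j y \<noteq> 0)}" by simp
  have d: "d \<le> K" "\<exists>y. A d y \<noteq> 0"
    using Max_in[OF fin] j0 unfolding d_def by blast+
  have above: "A j y = 0" if "j > d" "j \<le> K" for j y
    using Max_ge[OF fin, of j] that unfolding d_def by fastforce
  have rel: "(\<Sum>j\<le>d. A j (f x) * x $ i ^ j) = 0" for x
  proof -
    have "(\<Sum>j\<le>K. A j (f x) * x $ i ^ j) = (\<Sum>j\<le>d. A j (f x) * x $ i ^ j)"
      by (rule sum.mono_neutral_right) (use d(1) above in auto)
    then show ?thesis using c(4)[of x] by (simp add: A_def)
  qed
  have "d > 0"
  proof (rule ccontr)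
    assume "\<not> d > 0"
    then have "A d y = 0" if "y \<in> U" for y
      using rel that by fastforce
    then have "A d y = 0" for y
      using polyfun_eq_0_if_eq_0_on_open[OF polyA open_U] by blast
    then show False using d(2) by blast
  qed
  define h where "h y = 1 + (\<Sum>j<d. norm (A j y) * norm (A d y) ^ (d - 1 - j))" for y
  have "poly_growth h"
    unfolding h_def[abs_def]
    by (intro poly_growth_add poly_growth_const poly_growth_sum poly_growth_mult poly_growth_power
        poly_growth_norm_polyfun polyA)
  moreover have "norm (A d (f x) * x $ i) \<le> h (f x)" for x
    unfolding h_def by (rule leading_coeff_root_bound[OF rel \<open>d > 0\<close>])
  ultimately show ?thesis using polyA d(2) by blast
qed

lemma inverse_growth:
  obtains a h where "polyfun a" "\<exists>y. a y \<noteq> 0" "poly_growth h"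
    "\<And>y i. y \<in> U \<Longrightarrow> norm (a y * g y $ i) \<le> h y"
proof -
  have "\<forall>i. \<exists>a h. polyfun a \<and> (\<exists>y. a y \<noteq> 0) \<and> poly_growth h \<and> (\<forall>x. norm (a (f x) * x $ i) \<le> h (f x))"
    using coordinate_growth by blast
  then obtain a h where ah: "\<And>i. polyfun (a i)" "\<And>i. \<exists>y. a i y \<noteq> 0" "\<And>i. poly_growth (h i)"
    "\<And>i x. norm (a i (f x) * x $ i) \<le> h i (f x)"
    by metis
  define b where "b y = (\<Prod>i\<in>UNIV. a i y)" for y
  define H where "H y = (\<Sum>i\<in>UNIV. h i y * (\<Prod>j\<in>UNIV - {i}. norm (a j y)))" for y
  have "polyfun b" unfolding b_def[abs_def] by (intro polyfun_prod ah)
  moreover have "\<exists>y. b y \<noteq> 0"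
    unfolding b_def by (rule polyfun_prod_nonzero) (use ah in auto)
  moreover have "poly_growth H"
    unfolding H_def[abs_def]
    by (intro poly_growth_sum poly_growth_mult poly_growth_prod poly_growth_norm_polyfun ah)
  moreover have "norm (b y * g y $ i) \<le> H y" if "y \<in> U" for y i
  proof -
    have le: "norm (a i y * g y $ i) \<le> h i y" for i
      using ah(4)[of i "g y"] f_g[OF that] by simp
    have "b y * g y $ i = (a i y * g y $ i) * (\<Prod>j\<in>UNIV - {i}. a j y)"
      unfolding b_def by (subst prod.remove[of UNIV i]) auto
    then have "norm (b y * g y $ i) = norm (a i y * g y $ i) * (\<Prod>j\<in>UNIV - {i}. norm (a j y))"
      by (simp only: norm_mult prod_norm)
    also have "\<dots> \<le> h i y * (\<Prod>j\<in>UNIV - {i}. norm (a j y))"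
      by (intro mult_right_mono le prod_nonneg) auto
    also have "\<dots> \<le> H y"
      unfolding H_def
      by (rule member_le_sum) (auto intro!: mult_nonneg_nonneg prod_nonneg order_trans[OF norm_ge_zero le])
    finally show ?thesis .
  qed
  ultimately show ?thesis using that by blast
qed

end

section \<open>One-parameter families of rational functions\<close>

abbreviation eval_coeffs :: "complex \<Rightarrow> complex poly poly \<Rightarrow> complex poly" where
  "eval_coeffs z \<equiv> map_poly (\<lambda>c. poly c z)"

lemma coeff_eval_coeffs [simp]: "coeff (eval_coeffs z p) n = poly (coeff p n) z"
  by (simp add: coeff_map_poly)

lemma eval_coeffs_mult: "eval_coeffs z (p * q) = eval_coeffs z p * eval_coeffs z q"
  by (rule poly_eqI) (simp add: coeff_mult poly_sum)

lemma const_lead_coeff_eval_coeffs: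
  assumes "lead_coeff p = [:w:]" "w \<noteq> 0"
  shows "degree (eval_coeffs z p) = degree p" "lead_coeff (eval_coeffs z p) = w"
proof -
  have "degree (eval_coeffs z p) \<le> degree p" by (rule degree_le) (simp add: coeff_eq_0)
  moreover have "coeff (eval_coeffs z p) (degree p) = w" using assms by simp
  moreover from this have "degree p \<le> degree (eval_coeffs z p)"
    using assms(2) by (intro le_degree) simp
  ultimately show deg: "degree (eval_coeffs z p) = degree p" by simp
  show "lead_coeff (eval_coeffs z p) = w" unfolding deg using assms(1) by simp
qed

lemma is_unit_complex_polyE:
  assumes "is_unit (p :: complex poly)"
  obtains w where "p = [:w:]" "w \<noteq> 0"
  using assms by (auto simp: is_unit_poly_iff dvd_field_iff)

text \<open>
  Fatou's denominator \<open>B\<close> has constant term independent of the parameter. It divides \<open>Q\<close>, and since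
  the leading coefficient of \<open>Q\<close> is a unit of \<open>\<complex>[\<lambda>]\<close>, so is that of \<open>B\<close>. Thus, after normalising the
  constant term to 1, all members of the family have the same leading coefficient: the product of
  the roots of the denominator does not change with the parameter.
\<close>

lemma rational_family_denominator:
  fixes \<Gamma> :: "complex poly fps" and Q :: "complex poly poly"
  assumes lead: "lead_coeff Q = [:w:]" "w \<noteq> 0"
    and vanish: "\<And>n z. n > E \<Longrightarrow> poly (fps_nth (fps_of_poly Q * \<Gamma>) n) z = 0"
  obtains b c where "c \<noteq> 0" "\<And>z. b z dvd eval_coeffs z Q" "\<And>z. poly (b z) 0 = 1"
    "\<And>z. lead_coeff (b z) = c" "\<And>z. \<exists>P. fps_of_poly (b z) * fps_eval_coeffs z \<Gamma> = fps_of_poly P"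
proof -
  define A where "A = fps_of_poly Q * \<Gamma>"
  define P where "P = (\<Sum>n\<le>E. monom (fps_nth A n) n)"
  have A0: "fps_nth A n = 0" if "n > E" for n
    using vanish[OF that] poly_all_0_iff_0 unfolding A_def by blast
  have "A = fps_of_poly P"
  proof (rule fps_ext)
    fix n show "fps_nth A n = fps_nth (fps_of_poly P) n"
      using A0[of n] by (cases "n \<le> E") (auto simp: P_def coeff_sum)
  qed
  moreover have "Q \<noteq> 0" using lead by auto
  ultimately obtain B P' where B: "B dvd Q" "fps_of_poly B * \<Gamma> = fps_of_poly P'" "is_unit (coeff B 0)"
    using fatou_unit_denominator[of Q \<Gamma> P] unfolding A_def by metis
  obtain u where u: "coeff B 0 = [:u:]" "u \<noteq> 0" using is_unit_complex_polyE[OF B(3)] .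
  obtain R where R: "Q = B * R" using B(1) by (rule dvdE)
  have "lead_coeff B * lead_coeff R = [:w:]" using lead(1) by (simp add: R lead_coeff_mult)
  then have "lead_coeff B dvd [:w:]" by (metis dvd_triv_left)
  moreover have "is_unit [:w:]" using lead(2) by (simp add: is_unit_const_poly_iff dvd_field_iff)
  ultimately have "is_unit (lead_coeff B)" using dvd_trans by blast
  then obtain l where l: "lead_coeff B = [:l:]" "l \<noteq> 0" using is_unit_complex_polyE by blast
  define b where "b z = smult (inverse u) (eval_coeffs z B)" for z
  show ?thesis
  proof
    show "l / u \<noteq> 0" using u l by simp
    show "b z dvd eval_coeffs z Q" for z
      using u(2) by (simp add: b_def R eval_coeffs_mult smult_dvd_iff)
    show "poly (b z) 0 = 1" for z using u by (simp add: b_def poly_0_coeff_0)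
    show "lead_coeff (b z) = l / u" for z
      using const_lead_coeff_eval_coeffs(2)[OF l, of z] unfolding b_def lead_coeff_smult
      by (simp add: divide_inverse mult.commute)
    show "\<exists>P. fps_of_poly (b z) * fps_eval_coeffs z \<Gamma> = fps_of_poly P" for z
    proof
      have "fps_of_poly (eval_coeffs z B) * fps_eval_coeffs z \<Gamma> = fps_of_poly (eval_coeffs z P')"
        using arg_cong[OF B(2), of "fps_eval_coeffs z"]
        by (simp add: fps_eval_coeffs_mult fps_eval_coeffs_of_poly)
      then show "fps_of_poly (b z) * fps_eval_coeffs z \<Gamma> = fps_of_poly (smult (inverse u) (eval_coeffs z P'))"
        by (simp add: b_def fps_of_poly_smult mult.assoc)
    qed
  qed
qed

text \<open>
  Any root \<open>\<tau>\<close> of the denominator of \<open>p / Q\<close> in lowest terms is a root of every polynomial \<open>B\<close> that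
  clears the denominator.
\<close>

lemma exists_common_pole:
  fixes Q p :: "complex poly"
  assumes "Q \<noteq> 0" "\<not> Q dvd p"
  obtains \<tau> where "\<And>B. Q dvd B * p \<Longrightarrow> poly B \<tau> = 0"
proof -
  define d where "d = gcd Q p"
  have d0: "d \<noteq> 0" using assms(1) by (simp add: d_def)
  obtain Q' where Q': "Q = d * Q'" using gcd_dvd1[of Q p] unfolding d_def by (rule dvdE)
  obtain p' where p': "p = d * p'" using gcd_dvd2[of Q p] unfolding d_def by (rule dvdE)
  have cop: "coprime Q' p'"
  proof (rule gcd_coprime)
    show "gcd Q p \<noteq> 0" using d0 by (simp add: d_def)
    show "Q = Q' * gcd Q p" using Q' by (metis d_def mult.commute)
    show "p = p' * gcd Q p" using p' by (metis d_def mult.commute)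
  qed
  have "\<not> is_unit Q'"
  proof
    assume "is_unit Q'"
    then have "Q' dvd p'" by (rule unit_imp_dvd)
    then have "Q dvd p" unfolding Q' p' by (rule mult_dvd_mono[OF dvd_refl])
    then show False using assms(2) by simp
  qed
  moreover have "Q' \<noteq> 0" using assms(1) Q' by auto
  ultimately have "degree Q' \<noteq> 0" by (simp add: is_unit_iff_degree)
  then obtain \<tau> where \<tau>: "poly Q' \<tau> = 0"
    using fundamental_theorem_of_algebra_alt[of Q'] by (metis degree_pCons_0)
  have "poly B \<tau> = 0" if "Q dvd B * p" for B
  proof -
    have "d * Q' dvd d * (B * p')" using that by (simp add: Q' p' mult_ac)
    then have "Q' dvd B * p'" using d0 by simp
    then have "Q' dvd B" using cop by (simp add: coprime_dvd_mult_left_iff)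
    then show ?thesis using \<tau> by (auto elim!: dvdE)
  qed
  then show ?thesis by (rule that)
qed

lemma has_fps_expansion_poly: "poly p has_fps_expansion fps_of_poly p" for p :: "complex poly"
  by (simp add: has_fps_expansion_def)

lemma norm_scale: "norm (s *s v) = norm s * norm v" for v :: "complex ^ 'n::finite"
  by (simp add: norm_vec_def norm_mult L2_set_right_distrib)

lemma poly_eqI_off_roots:
  fixes p q r :: "complex poly"
  assumes "r \<noteq> 0" "\<And>z. poly r z \<noteq> 0 \<Longrightarrow> poly p z = poly q z"
  shows "p = q"
proof -
  have "poly ((p - q) * r) z = 0" for z using assms(2)[of z] by auto
  then have "(p - q) * r = 0" using poly_all_0_iff_0 by blast
  then show ?thesis using assms(1) by simp
qed

lemma norm_poly_le:
  fixes p :: "complex poly"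
  assumes "degree p \<le> D" "norm s \<ge> 1"
  shows "norm (poly p s) \<le> (\<Sum>k\<le>D. norm (coeff p k)) * norm s ^ D"
proof -
  have "norm (poly p s) \<le> (\<Sum>k\<le>degree p. norm (coeff p k * s ^ k))"
    unfolding poly_altdef by (rule norm_sum)
  also have "\<dots> \<le> (\<Sum>k\<le>D. norm (coeff p k * s ^ k))"
    by (rule sum_mono2) (use assms(1) in auto)
  also have "\<dots> \<le> (\<Sum>k\<le>D. norm (coeff p k) * norm s ^ D)"
    unfolding norm_mult norm_power
    by (intro sum_mono mult_left_mono power_increasing) (use assms(2) in auto)
  finally show ?thesis by (simp add: sum_distrib_right)
qed

section \<open>The inverse along a line\<close>

context unimodular_injection
begin

text \<open>
  The function \<open>a\<close> is a common denominator of the components of \<open>g\<close>, up to polynomial growth, and \<open>v\<close>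
  is a direction at which the leading form of \<open>a\<close> has a nonzero value \<open>w\<close>; \<open>b y\<close> is the restriction of
  \<open>a\<close> to the line through \<open>y\<close> in direction \<open>v\<close>.
\<close>

context
  fixes a :: "complex ^ 'n \<Rightarrow> complex" and C :: real and k :: nat and v :: "complex ^ 'n"
    and b :: "complex ^ 'n \<Rightarrow> complex poly" and D :: nat and w :: complex
  assumes growth: "\<And>y i. y \<in> U \<Longrightarrow> norm (a y * g y $ i) \<le> C * (1 + norm y) ^ k"
    and C_nonneg: "C \<ge> 0"
    and polyfun_b: "\<And>k. polyfun (\<lambda>y. coeff (b y) k)"
    and degree_b: "\<And>y. degree (b y) \<le> D"
    and lead_b: "\<And>y. coeff (b y) D = w"
    and w_nonzero: "w \<noteq> 0"
    and a_line: "\<And>y s. a (y + s *s v) = poly (b y) s"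
begin

lemma b_nonzero: "b y \<noteq> 0"
  using lead_b[of y] w_nonzero by auto

text \<open>
  Removing the finitely many zeros of \<open>b y\<close> leaves the complex line connected. The part of it that
  lies in \<open>U\<close> is open, and it is closed because \<open>g\<close> stays bounded where \<open>a\<close> is bounded away from 0: a
  limit of preimages is a preimage of the limit.
\<close>

lemma line_meets_image:
  assumes "y \<in> U" "poly (b y) s \<noteq> 0"
  shows "y + s *s v \<in> U"
proof -
  define S where "S = {s. poly (b y) s \<noteq> 0}"
  define W where "W = {s. y + s *s v \<in> U}"
  have finR: "finite {s. poly (b y) s = 0}" using poly_roots_finite[OF b_nonzero] .
  have S_eq: "S = UNIV - {s. poly (b y) s = 0}" by (auto simp: S_def)
  have "connected S" unfolding S_eq
    by (rule connected_open_delete_finite) (auto simp: finR)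
  moreover have "openin (top_of_set S) (S \<inter> W)"
    using open_line_domain[of y v] by (simp add: W_def openin_open_Int)
  moreover have "closedin (top_of_set S) (S \<inter> W)"
    unfolding closedin_limpt
  proof (intro conjI allI impI)
    fix s0 assume s0: "s0 islimpt S \<inter> W \<and> s0 \<in> S"
    then obtain s where s: "\<And>n::nat. s n \<in> S \<inter> W" "s \<longlonglongrightarrow> s0"
      using islimpt_sequential[of s0 "S \<inter> W"] by blast
    define z where "z n = y + s n *s v" for n
    define z0 where "z0 = y + s0 *s v"
    have zU: "z n \<in> U" and az: "a (z n) \<noteq> 0" for n
      using s(1)[of n] by (auto simp: z_def W_def S_def a_line)
    have az0: "a z0 \<noteq> 0" using s0 by (simp add: z0_def S_def a_line)
    have z: "z \<longlonglongrightarrow> z0"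
      unfolding z_def[abs_def] z0_def
      by (rule vec_tendstoI) (auto intro!: tendsto_intros s(2))
    have "(\<lambda>n. poly (b y) (s n)) \<longlonglongrightarrow> poly (b y) s0"
      by (intro tendsto_intros s(2))
    then have a: "(\<lambda>n. a (z n)) \<longlonglongrightarrow> a z0" by (simp add: z_def z0_def a_line)
    have "(\<lambda>n. C * (1 + norm (z n)) ^ k / norm (a (z n))) \<longlonglongrightarrow> C * (1 + norm z0) ^ k / norm (a z0)"
      by (intro tendsto_intros z a) (use az0 in simp)
    from convergent_imp_Bseq[OF convergentI[OF this]]
    obtain M where "\<forall>n. norm (C * (1 + norm (z n)) ^ k / norm (a (z n))) \<le> M"
      by (rule BseqE)
    then have M: "norm (C * (1 + norm (z n)) ^ k / norm (a (z n))) \<le> M" for n by (rule spec)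
    have bound: "norm (g (z n) $ i) \<le> M" for n i
    proof -
      have "norm (a (z n)) * norm (g (z n) $ i) \<le> C * (1 + norm (z n)) ^ k"
        using growth[OF zU[of n], of i] by (simp add: norm_mult)
      then have "norm (g (z n) $ i) \<le> C * (1 + norm (z n)) ^ k / norm (a (z n))"
        using az[of n] by (simp add: field_simps)
      also have "\<dots> \<le> M" using M[of n] by (metis abs_le_D1 real_norm_def)
      finally show ?thesis .
    qed
    have "norm (g (z n)) \<le> CARD('n) * M" for n
    proof -
      have "norm (g (z n)) \<le> (\<Sum>i\<in>UNIV. norm (g (z n) $ i))"
        unfolding norm_vec_def by (rule L2_set_le_sum) simp
      also have "\<dots> \<le> (\<Sum>i\<in>(UNIV::'n set). M)" by (intro sum_mono bound)
      finally show ?thesis by simp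
    qed
    then have "bounded (range (\<lambda>n. g (z n)))" unfolding bounded_iff by blast
    then obtain l r where lr: "strict_mono (r :: nat \<Rightarrow> nat)" "((\<lambda>n. g (z n)) \<circ> r) \<longlonglongrightarrow> l"
      using bounded_imp_convergent_subsequence by blast
    have "isCont f l" using continuous_on_f[of UNIV] by (simp add: continuous_on_eq_continuous_at)
    then have "(\<lambda>n. f (((\<lambda>n. g (z n)) \<circ> r) n)) \<longlonglongrightarrow> f l" using lr(2) by (rule isCont_tendsto_compose)
    then have "(z \<circ> r) \<longlonglongrightarrow> f l" using f_g[OF zU] by (simp add: o_def)
    moreover have "(z \<circ> r) \<longlonglongrightarrow> z0" by (rule LIMSEQ_subseq_LIMSEQ[OF z lr(1)])
    ultimately have "z0 = f l" using LIMSEQ_unique by blast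
    then show "s0 \<in> S \<inter> W" using s0 by (simp add: W_def z0_def[symmetric])
  qed simp
  moreover have "S \<inter> W \<noteq> {}"
  proof -
    have "eventually (\<lambda>s. y + s *s v \<in> U) (at 0)"
      by (rule eventually_line_in_open[OF open_U assms(1)])
    moreover have "eventually (\<lambda>s. s \<notin> {s. poly (b y) s = 0}) (at 0)"
      using islimpt_finite[OF finR] by (simp add: islimpt_iff_eventually)
    ultimately have "eventually (\<lambda>s. s \<in> S \<inter> W) (at 0)"
      by eventually_elim (auto simp: S_def W_def)
    then show ?thesis using eventually_happens'[OF at_neq_bot] by fastforce
  qed
  ultimately have "S \<inter> W = S" unfolding connected_clopen by blast
  then show ?thesis using assms(2) by (auto simp: S_def W_def)
qed

text \<open>
  Away from the zeros of \<open>b y\<close> the product of \<open>b y\<close> and \<open>g\<close> is holomorphic on the line and grows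
  polynomially. A second factor \<open>b y\<close> makes it continuous at the zeros, so they are removable, and
  Liouville's theorem applies to the entire function \<open>\<phi>\<close>.
\<close>

lemma inverse_rational_on_lines:
  assumes y: "y \<in> U"
  obtains p where "degree p \<le> D + k"
    "\<And>s. y + s *s v \<in> U \<Longrightarrow> poly p s = poly (b y) s ^ 2 * g (y + s *s v) $ i"
proof -
  define R where "R = {s. poly (b y) s = 0}"
  have finR: "finite R" unfolding R_def using poly_roots_finite[OF b_nonzero] .
  define \<phi> where "\<phi> s = (if s \<in> R then 0 else poly (b y) s ^ 2 * g (y + s *s v) $ i)" for s
  define m where "m s = norm (poly (b y) s) * (C * (1 + norm (y + s *s v)) ^ k)" for s
  have le: "norm (\<phi> s) \<le> m s" for s
  proof (cases "s \<in> R")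
    case True
    then show ?thesis using C_nonneg by (simp add: \<phi>_def m_def)
  next
    case False
    then have "y + s *s v \<in> U" using line_meets_image[OF y] by (simp add: R_def)
    then have "norm (poly (b y) s * g (y + s *s v) $ i) \<le> C * (1 + norm (y + s *s v)) ^ k"
      using growth[of "y + s *s v" i] by (simp add: a_line)
    then have "norm (poly (b y) s) * norm (poly (b y) s * g (y + s *s v) $ i) \<le> m s"
      unfolding m_def by (rule mult_left_mono) simp
    then show ?thesis using False by (simp add: \<phi>_def power2_eq_square norm_mult mult_ac)
  qed
  have "\<phi> holomorphic_on UNIV"
  proof (rule no_isolated_singularity'[OF _ _ open_UNIV finR])
    have "UNIV - R \<subseteq> {s. y + s *s v \<in> U}" using line_meets_image[OF y] by (auto simp: R_def)
    then have "(\<lambda>s. poly (b y) s ^ 2 * g (y + s *s v) $ i) holomorphic_on UNIV - R"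
      by (intro holomorphic_intros holomorphic_on_subset[OF holomorphic_g_line])
    then show "\<phi> holomorphic_on UNIV - R"
      by (rule holomorphic_transform) (simp add: \<phi>_def)
  next
    fix s0 assume s0: "s0 \<in> R"
    have line: "((\<lambda>s. y + s *s v) \<longlongrightarrow> y + s0 *s v) (at s0)"
      by (rule vec_tendstoI) (auto intro!: tendsto_eq_intros)
    have "(m \<longlongrightarrow> norm (poly (b y) s0) * (C * (1 + norm (y + s0 *s v)) ^ k)) (at s0)"
      unfolding m_def[abs_def] by (intro tendsto_intros line)
    then have "(m \<longlongrightarrow> 0) (at s0)" using s0 by (simp add: R_def)
    then have "(\<phi> \<longlongrightarrow> 0) (at s0)"
      by (rule Lim_null_comparison[rotated]) (simp add: le)
    then show "(\<phi> \<longlongrightarrow> \<phi> s0) (at s0 within UNIV)" using s0 by (simp add: \<phi>_def)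
  qed
  moreover define B where "B = (\<Sum>j\<le>D. norm (coeff (b y) j)) * (C * (1 + norm y + norm v) ^ k)"
  have "norm (\<phi> s) \<le> B * norm s ^ (D + k)" if s: "1 \<le> norm s" for s
  proof -
    have "norm y \<le> norm y * norm s" using s mult_left_mono[of 1 "norm s" "norm y"] by simp
    then have "1 + norm (y + s *s v) \<le> (1 + norm y + norm v) * norm s"
      using norm_triangle_ineq[of y "s *s v"] s by (simp add: norm_scale algebra_simps)
    then have "(1 + norm (y + s *s v)) ^ k \<le> (1 + norm y + norm v) ^ k * norm s ^ k"
      unfolding power_mult_distrib[symmetric] by (rule power_mono) simp
    then have "C * (1 + norm (y + s *s v)) ^ k \<le> C * (1 + norm y + norm v) ^ k * norm s ^ k"
      using C_nonneg by (simp add: mult.assoc mult_left_mono)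
    then have "m s \<le> ((\<Sum>j\<le>D. norm (coeff (b y) j)) * norm s ^ D) * (C * (1 + norm y + norm v) ^ k * norm s ^ k)"
      unfolding m_def using C_nonneg
      by (intro mult_mono[OF norm_poly_le[OF degree_b s]]) (auto intro!: mult_nonneg_nonneg sum_nonneg)
    also have "\<dots> = B * norm s ^ (D + k)" by (simp add: B_def power_add mult_ac)
    finally show ?thesis using le[of s] by simp
  qed
  ultimately have \<phi>: "\<phi> \<xi> = (\<Sum>j\<le>D + k. (deriv ^^ j) \<phi> 0 / fact j * \<xi> ^ j)" for \<xi>
    by (rule Liouville_polynomial)
  define p where "p = (\<Sum>j\<le>D + k. monom ((deriv ^^ j) \<phi> 0 / fact j) j)"
  have "degree p \<le> D + k"
    unfolding p_def by (rule degree_sum_le) (auto intro: order_trans[OF degree_monom_le])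
  moreover have "poly p s = \<phi> s" for s by (simp add: p_def poly_sum poly_monom \<phi>)
  ultimately show ?thesis
    using that[of p] by (simp add: \<phi>_def R_def)
qed

lemma taylor_g_rational:
  assumes "\<And>s. f x + s *s v \<in> U \<Longrightarrow> poly p s = poly (b (f x)) s ^ 2 * g (f x + s *s v) $ i"
  shows "fps_of_poly (b (f x) ^ 2) * taylor_g v i x = fps_of_poly p"
proof -
  have "(\<lambda>s. poly (b (f x) ^ 2) s * g (f x + s *s v) $ i) has_fps_expansion
      fps_of_poly (b (f x) ^ 2) * taylor_g v i x"
    by (intro has_fps_expansion_mult has_fps_expansion_poly has_fps_expansion_g_line)
  moreover have ev: "eventually (\<lambda>s. poly (b (f x) ^ 2) s * g (f x + s *s v) $ i = poly p s) (nhds 0)"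
  proof -
    have "eventually (\<lambda>s. s \<in> {s. f x + s *s v \<in> U}) (nhds 0)"
      by (rule eventually_nhds_in_open[OF open_line_domain]) simp
    then show ?thesis by eventually_elim (simp add: assms)
  qed
  ultimately have "poly p has_fps_expansion fps_of_poly (b (f x) ^ 2) * taylor_g v i x"
    by (simp only: has_fps_expansion_cong[OF ev refl])
  then show ?thesis by (rule fps_expansion_unique_complex[OF _ has_fps_expansion_poly])
qed

text \<open>
  The line from \<open>x0\<close> to \<open>x1\<close> in the source connects the Taylor series at these two points by a
  family with coefficients in \<open>\<complex>[\<lambda>]\<close>. The family is rational with denominator \<open>b (f x) ^ 2\<close>, whose
  leading coefficient \<open>w ^ 2\<close> is constant.
\<close>

lemma compare_denominators:
  obtains b0 b1 c where "c \<noteq> 0" "b0 dvd b (f x0) ^ 2" "b1 dvd b (f x1) ^ 2"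
    "poly b0 0 = 1" "poly b1 0 = 1" "lead_coeff b0 = c" "lead_coeff b1 = c"
    "\<exists>P. fps_of_poly b1 * taylor_g v i x1 = fps_of_poly P"
proof -
  define x where "x t = x0 + t *s (x1 - x0)" for t
  have "\<forall>k. \<exists>P. \<forall>t. fps_nth (taylor_g v i (x t)) k = poly P t"
  proof
    fix k
    have "polyfun (\<lambda>x. (derivation v ^^ k) (\<lambda>x. x $ i) x * inverse (fact k))"
      by (intro polyfun.mult polyfun_derivation_iterate polyfun.coord polyfun.const)
    then have "polyfun (\<lambda>x. fps_nth (taylor_g v i x) k)"
      by (simp add: taylor_g_def divide_inverse)
    from polyfun_line[OF this] show "\<exists>P. \<forall>t. fps_nth (taylor_g v i (x t)) k = poly P t"
      unfolding x_def by metis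
  qed
  then obtain \<gamma> where \<gamma>: "\<And>k t. fps_nth (taylor_g v i (x t)) k = poly (\<gamma> k) t" by metis
  have "\<forall>k. \<exists>P. \<forall>t. coeff (b (f (x t))) k = poly P t"
  proof
    fix k
    have "polyfun (\<lambda>x. coeff (b (f x)) k)" by (rule polyfun_compose[OF polyfun_b polyfun_f])
    from polyfun_line[OF this] show "\<exists>P. \<forall>t. coeff (b (f (x t))) k = poly P t"
      unfolding x_def by metis
  qed
  then obtain \<beta> where \<beta>: "\<And>k t. coeff (b (f (x t))) k = poly (\<beta> k) t" by metis
  define q where "q = (\<Sum>k\<le>D. monom (\<beta> k) k)"
  define \<Gamma> where "\<Gamma> = Abs_fps \<gamma>"
  have coeff_q: "coeff q k = (if k \<le> D then \<beta> k else 0)" for k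
    by (simp add: q_def coeff_sum)
  have ev_q: "eval_coeffs t q = b (f (x t))" for t
    using degree_b[of "f (x t)"] by (intro poly_eqI) (auto simp: coeff_q \<beta>[symmetric] coeff_eq_0)
  have ev_\<Gamma>: "fps_eval_coeffs t \<Gamma> = taylor_g v i (x t)" for t
    by (rule fps_ext) (simp add: \<Gamma>_def \<gamma>)
  have "poly (\<beta> D) t = poly [:w:] t" for t using \<beta>[of t D, symmetric] lead_b by simp
  then have \<beta>D: "\<beta> D = [:w:]" by (intro poly_eqI_off_roots[of 1]) auto
  have "degree q = D"
  proof (rule antisym)
    show "degree q \<le> D" by (rule degree_le) (simp add: coeff_q)
    show "D \<le> degree q" by (rule le_degree) (simp add: coeff_q \<beta>D w_nonzero)
  qed
  then have "lead_coeff q = [:w:]" by (simp add: coeff_q \<beta>D)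
  then have lead: "lead_coeff (q ^ 2) = [:w ^ 2:]"
    unfolding power2_eq_square lead_coeff_mult by simp
  \<comment> \<open>The numerators have bounded degree for every parameter, hence identically.\<close>
  have vanish: "poly (fps_nth (fps_of_poly (q ^ 2) * \<Gamma>) n) t = 0" if "n > D + k" for n t
  proof -
    obtain p where p: "degree p \<le> D + k"
      "\<And>s. f (x t) + s *s v \<in> U \<Longrightarrow> poly p s = poly (b (f (x t))) s ^ 2 * g (f (x t) + s *s v) $ i"
      using inverse_rational_on_lines[of "f (x t)" i] by blast
    have "fps_eval_coeffs t (fps_of_poly (q ^ 2) * \<Gamma>) = fps_of_poly p"
      using taylor_g_rational[OF p(2)]
      by (simp add: fps_eval_coeffs_mult fps_eval_coeffs_of_poly ev_\<Gamma> ev_q power2_eq_square eval_coeffs_mult)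
    then have "poly (fps_nth (fps_of_poly (q ^ 2) * \<Gamma>) n) t = coeff p n"
      by (metis fps_eval_coeffs_nth fps_of_poly_nth)
    then show ?thesis using p(1) that by (simp add: coeff_eq_0)
  qed
  obtain B c where B: "c \<noteq> 0" "\<And>z. B z dvd eval_coeffs z (q ^ 2)" "\<And>z. poly (B z) 0 = 1"
    "\<And>z. lead_coeff (B z) = c" "\<And>z. \<exists>P. fps_of_poly (B z) * fps_eval_coeffs z \<Gamma> = fps_of_poly P"
    using rational_family_denominator[OF lead _ vanish] w_nonzero by (metis power_not_zero)
  have x01: "x 0 = x0" "x 1 = x1" by (simp_all add: x_def)
  show ?thesis
  proof (rule that[of c "B 0" "B 1"])
    show "B 0 dvd b (f x0) ^ 2"
      using B(2)[of 0] by (simp add: power2_eq_square eval_coeffs_mult ev_q x01)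
    show "B 1 dvd b (f x1) ^ 2"
      using B(2)[of 1] by (simp add: power2_eq_square eval_coeffs_mult ev_q x01)
    show "\<exists>P. fps_of_poly (B 1) * taylor_g v i x1 = fps_of_poly P"
      using B(5)[of 1] by (simp add: ev_\<Gamma> x01)
  qed (use B in auto)
qed

lemma b_translate: "b (y + s *s v) = pcompose (b y) [:s, 1:]"
proof (rule poly_eqI_off_roots[of 1])
  fix z
  have eq: "y + s *s v + z *s v = y + (s + z) *s v" by (simp add: vec_eq_iff algebra_simps)
  have "poly (b (y + s *s v)) z = a (y + s *s v + z *s v)" by (simp only: a_line)
  also have "\<dots> = poly (b y) (s + z)" by (simp only: eq a_line)
  finally show "poly (b (y + s *s v)) z = poly (pcompose (b y) [:s, 1:]) z"
    by (simp add: poly_pcompose)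
qed simp

text \<open>
  Suppose that \<open>g\<close> has a genuine pole at the parameter \<open>\<tau>\<close> of the line through \<open>y\<close>. For \<open>\<sigma>\<close> close to \<open>\<tau>\<close>
  compare the preimages of \<open>y\<close> and of \<open>y2 = y + \<sigma> v\<close>: there are denominators \<open>b0\<close> and \<open>b1\<close> of \<open>g\<close>
  along the line, seen from \<open>y\<close> and from \<open>y2\<close>, with the same leading coefficient and with value 1 at
  the respective base point. Moved back to the base point \<open>y\<close> and made monic, both belong to the
  finite set \<open>MD\<close> of monic divisors of \<open>Q\<close>, and \<open>B1 \<sigma> = B0 0\<close>. But \<open>B1\<close> vanishes at \<open>\<tau>\<close>, so that
  \<open>B1 \<sigma>\<close> is small, while the finitely many nonzero numbers \<open>B 0\<close> with \<open>B\<close> in \<open>MD\<close> are bounded away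
  from 0.
\<close>

lemma inverse_pole_free:
  assumes "y \<in> U" and p: "\<And>s. y + s *s v \<in> U \<Longrightarrow> poly p s = poly (b y) s ^ 2 * g (y + s *s v) $ i"
  shows "b y ^ 2 dvd p"
proof (rule ccontr)
  define Q where "Q = b y ^ 2"
  assume "\<not> b y ^ 2 dvd p"
  then have ndvd: "\<not> Q dvd p" by (simp add: Q_def)
  have Q0: "Q \<noteq> 0" using b_nonzero by (simp add: Q_def)
  obtain \<tau> where \<tau>: "\<And>B. Q dvd B * p \<Longrightarrow> poly B \<tau> = 0"
    using exists_common_pole[OF Q0 ndvd] by blast
  define MD where "MD = {B. B dvd Q \<and> lead_coeff B = 1}"
  have finMD: "finite MD" unfolding MD_def by (rule finite_monic_divisors[OF Q0])
  define m where "m = Min (insert 1 ((\<lambda>B. norm (poly B 0)) ` {B \<in> MD. poly B 0 \<noteq> 0}))"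
  have m_pos: "m > 0" unfolding m_def using finMD by (subst Min_gr_iff) auto
  have m_le: "m \<le> norm (poly B 0)" if "B \<in> MD" "poly B 0 \<noteq> 0" for B
    unfolding m_def using finMD that by (intro Min_le) auto
  have "eventually (\<lambda>\<sigma>. \<forall>B\<in>MD. poly B \<tau> = 0 \<longrightarrow> norm (poly B \<sigma>) < m) (at \<tau>)"
  proof (rule eventually_ball_finite[OF finMD], rule ballI)
    fix B
    show "eventually (\<lambda>\<sigma>. poly B \<tau> = 0 \<longrightarrow> norm (poly B \<sigma>) < m) (at \<tau>)"
    proof (cases "poly B \<tau> = 0")
      case True
      have "((\<lambda>\<sigma>. norm (poly B \<sigma>)) \<longlongrightarrow> norm (poly B \<tau>)) (at \<tau>)" by (intro tendsto_intros)
      from order_tendstoD(2)[OF this, of m] True m_pos show ?thesis by simp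
    qed simp
  qed
  moreover have "eventually (\<lambda>\<sigma>. \<sigma> \<notin> {s. poly (b y) s = 0}) (at \<tau>)"
    using islimpt_finite[OF poly_roots_finite[OF b_nonzero]] by (simp add: islimpt_iff_eventually)
  ultimately have "eventually (\<lambda>\<sigma>. (\<forall>B\<in>MD. poly B \<tau> = 0 \<longrightarrow> norm (poly B \<sigma>) < m) \<and> poly (b y) \<sigma> \<noteq> 0) (at \<tau>)"
    by eventually_elim simp
  then obtain \<sigma> where \<sigma>: "\<And>B. B \<in> MD \<Longrightarrow> poly B \<tau> = 0 \<Longrightarrow> norm (poly B \<sigma>) < m" "poly (b y) \<sigma> \<noteq> 0"
    using eventually_happens'[OF at_neq_bot] by blast
  define y2 where "y2 = y + \<sigma> *s v"
  have y2: "y2 \<in> U" unfolding y2_def by (rule line_meets_image[OF assms(1) \<sigma>(2)])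
  have f1: "f (g y) = y" and f2: "f (g y2) = y2" using f_g assms(1) y2 by auto
  have shift_back: "pcompose (pcompose r [:\<sigma>, 1:]) [:- \<sigma>, 1:] = r" for r :: "complex poly"
    by (simp add: pcompose_assoc[symmetric] pcompose_pCons)
  have Q2: "b y2 ^ 2 = pcompose Q [:\<sigma>, 1:]"
    by (simp add: y2_def b_translate Q_def power2_eq_square pcompose_mult)
  have p2: "poly (pcompose p [:\<sigma>, 1:]) s = poly (b y2) s ^ 2 * g (y2 + s *s v) $ i"
    if "y2 + s *s v \<in> U" for s
  proof -
    have eq: "y2 + s *s v = y + (\<sigma> + s) *s v" by (simp add: y2_def vec_eq_iff algebra_simps)
    have "poly p (\<sigma> + s) = poly (b y) (\<sigma> + s) ^ 2 * g (y2 + s *s v) $ i"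
      using p[of "\<sigma> + s"] that unfolding eq by blast
    moreover have "b y2 = pcompose (b y) [:\<sigma>, 1:]" by (simp add: y2_def b_translate)
    ultimately show ?thesis by (simp add: poly_pcompose)
  qed
  obtain b0 b1 c where bb: "c \<noteq> 0" "b0 dvd Q" "b1 dvd b y2 ^ 2"
    "poly b0 0 = 1" "poly b1 0 = 1" "lead_coeff b0 = c" "lead_coeff b1 = c"
    "\<exists>P. fps_of_poly b1 * taylor_g v i (g y2) = fps_of_poly P"
  proof (rule compare_denominators[of "g y" "g y2" i])
    fix c b0 b1
    assume "c \<noteq> 0" "b0 dvd b (f (g y)) ^ 2" "b1 dvd b (f (g y2)) ^ 2"
      "poly b0 0 = 1" "poly b1 0 = 1" "lead_coeff b0 = c" "lead_coeff b1 = c"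
      "\<exists>P. fps_of_poly b1 * taylor_g v i (g y2) = fps_of_poly P"
    then show thesis unfolding f1 f2 Q_def[symmetric] by (rule that)
  qed
  define B0 where "B0 = smult (inverse c) b0"
  define B1 where "B1 = smult (inverse c) (pcompose b1 [:- \<sigma>, 1:])"
  have "B0 \<in> MD" using bb by (simp add: MD_def B0_def smult_dvd_iff)
  have "pcompose b1 [:- \<sigma>, 1:] dvd Q"
  proof -
    obtain r where "pcompose Q [:\<sigma>, 1:] = b1 * r" using bb(3) unfolding Q2 by (rule dvdE)
    then have "Q = pcompose b1 [:- \<sigma>, 1:] * pcompose r [:- \<sigma>, 1:]"
      using shift_back[of Q] by (simp add: pcompose_mult)
    then show ?thesis by simp
  qed
  moreover have "lead_coeff (pcompose b1 [:- \<sigma>, 1:]) = c"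
    using bb(7) by (subst lead_coeff_comp) auto
  ultimately have "B1 \<in> MD" using bb(1) by (simp add: MD_def B1_def smult_dvd_iff lead_coeff_smult)
  have "poly B1 \<tau> = 0"
  proof (rule \<tau>)
    obtain P where P: "fps_of_poly b1 * taylor_g v i (g y2) = fps_of_poly P" using bb(8) by blast
    have "fps_of_poly (b y2 ^ 2) * taylor_g v i (g y2) = fps_of_poly (pcompose p [:\<sigma>, 1:])"
      using taylor_g_rational[of "g y2" "pcompose p [:\<sigma>, 1:]" i] p2 unfolding f2 by blast
    then have "fps_of_poly (b1 * pcompose p [:\<sigma>, 1:]) = fps_of_poly (b y2 ^ 2 * P)"
      unfolding fps_of_poly_mult P[symmetric] by (metis mult.left_commute)
    then have "b1 * pcompose p [:\<sigma>, 1:] = pcompose Q [:\<sigma>, 1:] * P"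
      by (simp add: fps_of_poly_eq_iff Q2)
    then have "pcompose (b1 * pcompose p [:\<sigma>, 1:]) [:- \<sigma>, 1:] = pcompose (pcompose Q [:\<sigma>, 1:] * P) [:- \<sigma>, 1:]"
      by simp
    then have "pcompose b1 [:- \<sigma>, 1:] * p = Q * pcompose P [:- \<sigma>, 1:]"
      by (simp add: pcompose_mult shift_back)
    then have "B1 * p = Q * smult (inverse c) (pcompose P [:- \<sigma>, 1:])"
      by (simp add: B1_def)
    then show "Q dvd B1 * p" by (metis dvd_triv_left)
  qed
  then have "norm (poly B1 \<sigma>) < m" using \<sigma>(1) \<open>B1 \<in> MD\<close> by blast
  moreover have "poly B1 \<sigma> = poly B0 0" using bb by (simp add: B0_def B1_def poly_pcompose)
  moreover have "poly B0 0 \<noteq> 0" using bb by (simp add: B0_def)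
  ultimately show False using m_le[OF \<open>B0 \<in> MD\<close>] by simp
qed

text \<open>
  Off the zeros of \<open>b y\<close>, \<open>g\<close> agrees on the line with a polynomial curve \<open>\<gamma>\<close>. Then \<open>f (\<gamma> s)\<close> and
  \<open>y + s v\<close> are polynomial curves that agree off these zeros, so they are equal, and the whole line
  lies in \<open>U\<close>.
\<close>

lemma inverse_polynomial_on_line:
  assumes "y \<in> U"
  obtains r where "\<And>i. degree (r i) \<le> D + k"
    "\<And>s. y + s *s v \<in> U" "\<And>s i. g (y + s *s v) $ i = poly (r i) s"
proof -
  have "\<exists>r. degree r \<le> D + k \<and> (\<forall>s. poly (b y) s \<noteq> 0 \<longrightarrow> g (y + s *s v) $ i = poly r s)" for i
  proof -
    obtain p where p: "degree p \<le> D + k"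
      "\<And>s. y + s *s v \<in> U \<Longrightarrow> poly p s = poly (b y) s ^ 2 * g (y + s *s v) $ i"
      by (rule inverse_rational_on_lines[OF assms, of i]) blast
    obtain r where r: "p = b y ^ 2 * r" using inverse_pole_free[OF assms p(2)] by (rule dvdE)
    have "g (y + s *s v) $ i = poly r s" if "poly (b y) s \<noteq> 0" for s
      using p(2)[OF line_meets_image[OF assms that]] that by (simp add: r)
    moreover have "degree r \<le> D + k"
    proof (cases "r = 0")
      case False
      then have "degree p = degree (b y ^ 2) + degree r"
        unfolding r using b_nonzero by (intro degree_mult_eq) auto
      then show ?thesis using p(1) by simp
    qed simp
    ultimately show ?thesis by blast
  qed
  then obtain r where r: "\<And>i. degree (r i) \<le> D + k"
    "\<And>i s. poly (b y) s \<noteq> 0 \<Longrightarrow> g (y + s *s v) $ i = poly (r i) s"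
    by metis
  define \<gamma> where "\<gamma> s = (\<chi> i. poly (r i) s)" for s
  have eq: "f (\<gamma> s) = y + s *s v" for s
  proof (rule vec_eq_iff[THEN iffD2], rule allI)
    fix j
    obtain P where P: "\<And>s. f (\<gamma> s) $ j = poly P s"
      unfolding \<gamma>_def using polyfun_curve[OF polyfun_f] by blast
    have "P = [:y $ j, v $ j:]"
    proof (rule poly_eqI_off_roots[OF b_nonzero[of y]])
      fix s assume s: "poly (b y) s \<noteq> 0"
      then have "\<gamma> s = g (y + s *s v)" using r(2) by (simp add: \<gamma>_def vec_eq_iff)
      then have "f (\<gamma> s) = y + s *s v" using f_g line_meets_image[OF assms s] by simp
      then show "poly P s = poly [:y $ j, v $ j:] s" by (simp add: P[symmetric])
    qed
    then show "f (\<gamma> s) $ j = (y + s *s v) $ j" by (simp add: P)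
  qed
  show ?thesis
  proof (rule that[of r])
    show "y + s *s v \<in> U" for s using eq[of s] by (metis rangeI)
    show "g (y + s *s v) $ i = poly (r i) s" for s i
      by (simp add: eq[symmetric]) (simp add: \<gamma>_def)
  qed (rule r(1))
qed

end

end

section \<open>Separately polynomial functions\<close>

definition vec_upd :: "'a ^ 'n \<Rightarrow> 'n \<Rightarrow> 'a \<Rightarrow> 'a ^ 'n" where
  "vec_upd y i c = (\<chi> j. if j = i then c else y $ j)"

lemma vec_upd_nth [simp]: "vec_upd y i c $ j = (if j = i then c else y $ j)"
  by (simp add: vec_upd_def)

text \<open>
  Polynomiality of bounded degree in a single variable is expressed by an interpolation formula with
  fixed nodes. Applying it to one variable after the other reduces \<open>G\<close> to functions of fewer
  variables. The induction is over the set \<open>S\<close> of variables on which \<open>G\<close> depends.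
\<close>

lemma polyfun_if_interpolable:
  fixes G :: "complex ^ 'n::finite \<Rightarrow> complex" and l :: "nat \<Rightarrow> complex poly"
  assumes "finite S" "\<And>y y'. (\<And>i. i \<in> S \<Longrightarrow> y $ i = y' $ i) \<Longrightarrow> G y = G y'"
    and "\<And>i y. i \<in> S \<Longrightarrow> G y = (\<Sum>k\<le>E. G (vec_upd y i (of_nat k)) * poly (l k) (y $ i))"
  shows "polyfun G"
  using assms
proof (induction S arbitrary: G rule: finite_induct)
  case empty
  have "G = (\<lambda>y. G 0)" by (rule ext, rule empty(1)) simp
  then show ?case using polyfun.const by metis
next
  case (insert i S)
  define Gk where "Gk k y = G (vec_upd y i (of_nat k))" for k and y :: "complex ^ 'n"
  have "polyfun (Gk k)" for k
  proof (rule insert.IH)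
    fix y y' :: "complex ^ 'n" assume "\<And>j. j \<in> S \<Longrightarrow> y $ j = y' $ j"
    then show "Gk k y = Gk k y'" unfolding Gk_def by (intro insert.prems(1)) auto
  next
    fix j and y :: "complex ^ 'n" assume j: "j \<in> S"
    then have ji: "j \<noteq> i" using insert.hyps by auto
    have upd: "vec_upd (vec_upd y i c) j d = vec_upd (vec_upd y j d) i c" for c d
      using ji by (simp add: vec_eq_iff)
    have "Gk k y = (\<Sum>m\<le>E. G (vec_upd (vec_upd y i (of_nat k)) j (of_nat m))
        * poly (l m) (vec_upd y i (of_nat k) $ j))"
      unfolding Gk_def using j by (intro insert.prems(2)) simp
    then show "Gk k y = (\<Sum>m\<le>E. Gk k (vec_upd y j (of_nat m)) * poly (l m) (y $ j))"
      using ji by (simp add: Gk_def upd)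
  qed
  then have "polyfun (\<lambda>y. \<Sum>k\<le>E. Gk k y * poly (l k) (y $ i))"
    by (intro polyfun_sum polyfun.mult polyfun_poly polyfun.coord)
  moreover have "G y = (\<Sum>k\<le>E. Gk k y * poly (l k) (y $ i))" for y
    unfolding Gk_def by (rule insert.prems(2)) simp
  ultimately show ?case by presburger
qed

section \<open>Surjectivity and polynomiality of the inverse\<close>

context unimodular_injection
begin

lemma inverse_polynomial_in_general_directions:
  obtains E T v0 where "polyfun T" "T v0 \<noteq> 0"
    "\<And>v y. T v \<noteq> 0 \<Longrightarrow> y \<in> U \<Longrightarrow>
       \<exists>r. (\<forall>i. degree (r i) \<le> E) \<and> (\<forall>s. y + s *s v \<in> U \<and> (\<forall>i. g (y + s *s v) $ i = poly (r i) s))"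
proof -
  obtain a h where a: "polyfun a" "\<exists>y. a y \<noteq> 0" "poly_growth h"
    "\<And>y i. y \<in> U \<Longrightarrow> norm (a y * g y $ i) \<le> h y"
    by (rule inverse_growth) blast
  obtain C k where C: "C \<ge> 0" "\<And>x. \<bar>h x\<bar> \<le> C * (1 + norm x) ^ k"
    using a(3) unfolding poly_growth_def by blast
  have growth: "norm (a y * g y $ i) \<le> C * (1 + norm y) ^ k" if "y \<in> U" for y i
    using a(4)[OF that, of i] C(2)[of y] by linarith
  obtain x where "a x \<noteq> 0" using a(2) by blast
  obtain D T v0 where T: "polyfun T" "T v0 \<noteq> 0" "line_expansion D a T"
    by (rule line_expansion_exists[OF a(1) \<open>a x \<noteq> 0\<close>])
  show ?thesis
  proof (rule that[OF T(1,2)])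
    fix v y assume Tv: "T v \<noteq> 0" and y: "y \<in> U"
    obtain b where b: "\<And>k. polyfun (\<lambda>y. coeff (b y) k)" "\<And>y. degree (b y) \<le> D"
      "\<And>y. coeff (b y) D = T v" "\<And>y s. a (y + s *s v) = poly (b y) s"
      using T(3) unfolding line_expansion_def by metis
    show "\<exists>r. (\<forall>i. degree (r i) \<le> D + k) \<and>
        (\<forall>s. y + s *s v \<in> U \<and> (\<forall>i. g (y + s *s v) $ i = poly (r i) s))"
    proof (rule inverse_polynomial_on_line[OF growth C(1) b(1,2,3) Tv b(4) y])
      fix r
      assume "\<And>i. degree (r i) \<le> D + k" "\<And>s. y + s *s v \<in> U"
        "\<And>s i. g (y + s *s v) $ i = poly (r i) s"
      then show ?thesis by blast
    qed
  qed
qed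

text \<open>
  Every point \<open>z\<close> is reached from the open set \<open>U\<close> along a direction with \<open>T \<noteq> 0\<close>, and the line stays
  in \<open>U\<close>; so \<open>f\<close> is surjective. The interpolation formula for \<open>g\<close>, valid in directions with
  \<open>T \<noteq> 0\<close>, then extends to all directions by continuity, in particular to those of the axes.
\<close>

lemma
  shows surj_f: "U = UNIV"
    and polyfun_g: "polyfun (\<lambda>y. g y $ i)"
proof -
  obtain E T v0 where T: "polyfun T" "T v0 \<noteq> 0"
    and lines: "\<And>v y. T v \<noteq> 0 \<Longrightarrow> y \<in> U \<Longrightarrow>
       \<exists>r. (\<forall>i. degree (r i) \<le> E) \<and> (\<forall>s. y + s *s v \<in> U \<and> (\<forall>i. g (y + s *s v) $ i = poly (r i) s))"
    by (rule inverse_polynomial_in_general_directions) blast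
  show U: "U = UNIV"
  proof (rule UNIV_eq_I[symmetric])
    fix z
    have "\<exists>y\<in>U. T (z - y) \<noteq> 0"
    proof (rule ccontr)
      assume "\<not> (\<exists>y\<in>U. T (z - y) \<noteq> 0)"
      then have van: "T (z - y) = 0" if "y \<in> U" for y using that by blast
      have "polyfun (\<lambda>y. T (z - y))"
        by (rule polyfun_compose[OF T(1)]) (simp add: polyfun_diff polyfun.const polyfun.coord)
      then have "T (z - (z - v0)) = 0"
        by (rule polyfun_eq_0_if_eq_0_on_open[OF _ open_U _ van]) blast
      then show False using T(2) by simp
    qed
    then obtain y where y: "y \<in> U" "T (z - y) \<noteq> 0" by blast
    have "y + 1 *s (z - y) \<in> U" using lines[OF y(2,1)] by blast
    then show "z \<in> U" by (simp add: vec_eq_iff[symmetric])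
  qed
  obtain l :: "nat \<Rightarrow> complex poly" where l: "\<And>p. degree p \<le> E \<Longrightarrow> p = (\<Sum>k\<le>E. smult (poly p (of_nat k)) (l k))"
    by (rule lagrange_interpolation[of E]) blast
  define \<delta> where "\<delta> y s v = g (y + s *s v) $ i - (\<Sum>k\<le>E. g (y + of_nat k *s v) $ i * poly (l k) s)" for y s v
  have general: "\<delta> y s v = 0" if Tv: "T v \<noteq> 0" for y s v
  proof -
    obtain r where r: "\<And>i. degree (r i) \<le> E" "\<And>s i. g (y + s *s v) $ i = poly (r i) s"
      using lines[OF Tv, of y] U by blast
    have "poly (r i) s = poly (\<Sum>k\<le>E. smult (poly (r i) (of_nat k)) (l k)) s" using l[OF r(1)] by metis
    then show ?thesis by (simp add: \<delta>_def r(2) poly_sum)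
  qed
  have all: "\<delta> y s v = 0" for y s v
  proof -
    have "eventually (\<lambda>t. T (v + t *s (v0 - v)) \<noteq> 0) (at 0)"
    proof -
      obtain P where P: "\<And>t. T (v + t *s (v0 - v)) = poly P t" using polyfun_line[OF T(1)] by blast
      have "v + 1 *s (v0 - v) = v0" by (simp add: vec_eq_iff)
      then have "P \<noteq> 0" using P[of 1] T(2) by auto
      then have "eventually (\<lambda>t. t \<notin> {t. poly P t = 0}) (at 0)"
        using islimpt_finite[OF poly_roots_finite] by (simp add: islimpt_iff_eventually)
      then show ?thesis unfolding P by simp
    qed
    then have "eventually (\<lambda>t. \<delta> y s (v + t *s (v0 - v)) = 0) (at 0)"
      by eventually_elim (rule general)
    then have "((\<lambda>t. \<delta> y s (v + t *s (v0 - v))) \<longlongrightarrow> 0) (at 0)"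
      by (rule tendsto_eventually)
    moreover have "((\<lambda>t. \<delta> y s (v + t *s (v0 - v))) \<longlongrightarrow> \<delta> y s v) (at 0)"
    proof -
      have "((\<lambda>t. y + c *s (v + t *s (v0 - v))) \<longlongrightarrow> y + c *s v) (at 0)" for c
        by (rule vec_tendstoI) (auto intro!: tendsto_eq_intros)
      then have lim: "((\<lambda>t. g (y + c *s (v + t *s (v0 - v))) $ i) \<longlongrightarrow> g (y + c *s v) $ i) (at 0)" for c
        by (intro tendsto_vec_nth isCont_tendsto_compose[OF isCont_g]) (auto simp: U)
      show ?thesis
        unfolding \<delta>_def by (intro tendsto_diff tendsto_sum tendsto_mult tendsto_const lim)
    qed
    ultimately show ?thesis using tendsto_unique[OF at_neq_bot] by blast
  qed
  show "polyfun (\<lambda>y. g y $ i)"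
  proof (rule polyfun_if_interpolable[of UNIV])
    fix y y' :: "complex ^ 'n" assume "\<And>j. j \<in> UNIV \<Longrightarrow> y $ j = y' $ j"
    then have "y = y'" by (simp add: vec_eq_iff)
    then show "g y $ i = g y' $ i" by simp
  next
    fix j and y :: "complex ^ 'n"
    have "vec_upd y j 0 + c *s axis j 1 = vec_upd y j c" for c
      by (simp add: vec_eq_iff axis_def)
    moreover have "vec_upd y j (y $ j) = y" by (simp add: vec_eq_iff)
    ultimately show "g y $ i = (\<Sum>k\<le>E. g (vec_upd y j (of_nat k)) $ i * poly (l k) (y $ j))"
      using all[of "vec_upd y j 0" "y $ j" "axis j 1"] by (simp add: \<delta>_def)
  qed simp
qed

end

section \<open>Polynomials of bounded degree vanishing on a simplex\<close>

text \<open>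
  Polynomials of total degree at most \<open>n\<close> in finitely many of the variables \<open>b 0, b 1, \<dots>\<close>, generated
  so that taking a difference lowers the degree by induction.
\<close>

inductive deg_le :: "nat \<Rightarrow> ((nat \<Rightarrow> complex) \<Rightarrow> complex) \<Rightarrow> bool" where
  const: "deg_le n (\<lambda>b. c)"
| add: "deg_le n p \<Longrightarrow> deg_le n q \<Longrightarrow> deg_le n (\<lambda>b. p b + q b)"
| coord_mult: "deg_le n p \<Longrightarrow> deg_le (Suc n) (\<lambda>b. b j * p b)"
| Suc: "deg_le n p \<Longrightarrow> deg_le (Suc n) p"

lemma deg_le_cmult: "deg_le n p \<Longrightarrow> deg_le n (\<lambda>b. c * p b)"
proof (induction rule: deg_le.induct)
  case (coord_mult n p j)
  from deg_le.coord_mult[OF coord_mult.IH, of j] show ?case by (simp add: mult.left_commute)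
next
  case (add n p q)
  from deg_le.add[OF add.IH] show ?case by (simp add: distrib_left)
qed (auto intro: deg_le.intros)

lemma deg_le_sum: "(\<And>a. a \<in> A \<Longrightarrow> deg_le n (p a)) \<Longrightarrow> deg_le n (\<lambda>b. \<Sum>a\<in>A. p a b)"
  by (induction A rule: infinite_finite_induct) (auto intro: deg_le.intros)

lemma deg_le_affine_mult:
  assumes "deg_le n p"
  shows "deg_le (Suc n) (\<lambda>b. (c + (\<Sum>j\<in>A. b j * d j)) * p b)"
proof -
  have "deg_le (Suc n) (\<lambda>b. c * p b + (\<Sum>j\<in>A. b j * (d j * p b)))"
    by (intro deg_le.add deg_le_sum deg_le.coord_mult deg_le.Suc deg_le_cmult assms)
  then show ?thesis by (simp add: distrib_right sum_distrib_right mult.assoc)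
qed

lemma deg_le_affine_prod:
  assumes "finite I"
  shows "deg_le (card I) (\<lambda>b. \<Prod>i\<in>I. c i + (\<Sum>j\<in>A. b j * d i j))"
  using assms by (induction I rule: finite_induct) (auto intro: deg_le.const deg_le_affine_mult)

lemma deg_le_shift: "deg_le n p \<Longrightarrow> deg_le n (\<lambda>b. p (b(k := b k + 1)))"
proof (induction rule: deg_le.induct)
  case (coord_mult n p j)
  have "deg_le (Suc n) (\<lambda>b. b j * p (b(k := b k + 1)) + (if j = k then 1 else 0) * p (b(k := b k + 1)))"
    by (intro deg_le.add deg_le.coord_mult deg_le.Suc deg_le_cmult coord_mult.IH)
  moreover have "(\<lambda>b. b j * p (b(k := b k + 1)) + (if j = k then 1 else 0) * p (b(k := b k + 1)))
     = (\<lambda>b. (b(k := b k + 1)) j * p (b(k := b k + 1)))"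
    by (auto simp: fun_eq_iff algebra_simps)
  ultimately show ?case by (simp only:)
qed (auto intro: deg_le.intros)

definition forward_diff :: "nat \<Rightarrow> ((nat \<Rightarrow> complex) \<Rightarrow> complex) \<Rightarrow> (nat \<Rightarrow> complex) \<Rightarrow> complex" where
  "forward_diff k p b = p (b(k := b k + 1)) - p b"

lemma deg_le_forward_diff:
  "deg_le n p \<Longrightarrow> (case n of 0 \<Rightarrow> \<forall>b. forward_diff k p b = 0 | Suc n' \<Rightarrow> deg_le n' (forward_diff k p))"
proof (induction rule: deg_le.induct)
  case (const n c)
  then show ?case by (auto simp: forward_diff_def[abs_def] split: nat.split intro: deg_le.const)
next
  case (add n p q)
  have "forward_diff k (\<lambda>b. p b + q b) = (\<lambda>b. forward_diff k p b + forward_diff k q b)"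
    by (simp add: forward_diff_def fun_eq_iff)
  then show ?case using add.IH by (auto split: nat.splits intro: deg_le.add)
next
  case (coord_mult n p j)
  have eq: "forward_diff k (\<lambda>b. b j * p b)
      = (\<lambda>b. b j * forward_diff k p b + (if j = k then 1 else 0) * p (b(k := b k + 1)))"
    by (auto simp: forward_diff_def fun_eq_iff algebra_simps)
  have "deg_le n (\<lambda>b. b j * forward_diff k p b)"
  proof (cases n)
    case 0
    then show ?thesis using coord_mult.IH by (simp add: deg_le.const)
  next
    case (Suc n')
    then show ?thesis using coord_mult.IH by (auto intro: deg_le.coord_mult)
  qed
  then have "deg_le n (forward_diff k (\<lambda>b. b j * p b))"
    unfolding eq by (intro deg_le.add deg_le_cmult deg_le_shift coord_mult.hyps)
  then show ?case by simp
next
  case (Suc n p)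
  have "deg_le n (forward_diff k p)"
  proof (cases n)
    case 0
    then have "forward_diff k p = (\<lambda>b. 0)" using Suc.IH by (simp add: fun_eq_iff)
    then show ?thesis by (simp add: deg_le.const)
  next
    case (Suc n')
    then show ?thesis using Suc.IH by (auto intro: deg_le.Suc)
  qed
  then show ?case by simp
qed

lemma deg_le_coord_poly: "deg_le n p \<Longrightarrow> \<exists>P. \<forall>t. p (b(k := t)) = poly P t"
proof (induction rule: deg_le.induct)
  case (const n c)
  show ?case by (rule exI[of _ "[:c:]"]) simp
next
  case (add n p q)
  then show ?case by (metis poly_add)
next
  case (coord_mult n p j)
  then obtain P where P: "\<And>t. p (b(k := t)) = poly P t" by blast
  have "(b(k := t)) j = poly (if j = k then [:0, 1:] else [:b j:]) t" for t by simp
  then show ?case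
    by (intro exI[of _ "(if j = k then [:0, 1:] else [:b j:]) * P"]) (simp only: P poly_mult simp_thms)
qed

lemma poly_const_if_periodic:
  fixes P :: "complex poly"
  assumes "\<And>t. poly P (t + 1) = poly P t"
  shows "poly P t = poly P 0"
proof -
  have nat: "poly P (of_nat m) = poly P 0" for m
  proof (induction m)
    case (Suc m)
    then show ?case using assms[of "of_nat m"] by (simp add: add.commute)
  qed simp
  have "P - [:poly P 0:] = 0"
  proof (rule ccontr)
    assume "P - [:poly P 0:] \<noteq> 0"
    then have "finite {t. poly (P - [:poly P 0:]) t = 0}" by (rule poly_roots_finite)
    moreover have "range of_nat \<subseteq> {t. poly (P - [:poly P 0:]) t = 0}" using nat by auto
    ultimately have "finite (range (of_nat :: nat \<Rightarrow> complex))" using finite_subset by blast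
    then show False using range_inj_infinite[OF inj_of_nat] by blast
  qed
  then have "poly (P - [:poly P 0:]) t = 0" by (simp only: poly_0)
  then show ?thesis by simp
qed

lemma const_if_forward_diff_0:
  assumes "deg_le n p" "finite A"
    and diff: "\<And>k b. k \<in> A \<Longrightarrow> (\<And>j. j \<notin> A \<Longrightarrow> b j = 0) \<Longrightarrow> forward_diff k p b = 0"
    and b: "\<And>j. j \<notin> A \<Longrightarrow> b j = 0"
  shows "p b = p (\<lambda>j. 0)"
proof -
  have one: "p (b'(k := 0)) = p b'" if k: "k \<in> A" and b': "\<And>j. j \<notin> A \<Longrightarrow> b' j = 0" for k b'
  proof -
    obtain P where P: "\<And>t. p (b'(k := t)) = poly P t"
      using deg_le_coord_poly[OF assms(1)] by blast
    have "poly P (t + 1) = poly P t" for t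
    proof -
      have "forward_diff k p (b'(k := t)) = 0" by (rule diff[OF k]) (use b' k in auto)
      then show ?thesis by (simp add: forward_diff_def P)
    qed
    from poly_const_if_periodic[OF this, of "b' k"] show ?thesis
      unfolding P[symmetric] by simp
  qed
  have "p (\<lambda>j. if j \<in> B then 0 else b j) = p b" if "finite B" "B \<subseteq> A" for B
    using that
  proof (induction B rule: finite_induct)
    case (insert k B)
    have "(\<lambda>j. if j \<in> insert k B then 0 else b j) = (\<lambda>j. if j \<in> B then 0 else b j)(k := 0)"
      by auto
    then show ?case
      using insert b by (simp only:) (subst one, auto)
  qed simp
  from this[OF assms(2) subset_refl] have "p (\<lambda>j. if j \<in> A then 0 else b j) = p b" .
  moreover have "(\<lambda>j. if j \<in> A then 0 else b j) = (\<lambda>j. 0)" using b by auto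
  ultimately show ?thesis by simp
qed

text \<open>
  A forward difference of \<open>p\<close> has lower degree and vanishes on the next smaller simplex, so it is 0
  by induction. Hence \<open>p\<close> is periodic in each variable, which forces a polynomial to be constant.
\<close>

lemma deg_le_eq_0_if_zero_on_simplex:
  assumes "deg_le n p" "n \<le> m" "finite A"
    and "\<And>c :: nat \<Rightarrow> nat. (\<And>j. j \<notin> A \<Longrightarrow> c j = 0) \<Longrightarrow> (\<Sum>j\<in>A. c j) \<le> m \<Longrightarrow> p (\<lambda>j. of_nat (c j)) = 0"
    and "\<And>j. j \<notin> A \<Longrightarrow> b j = 0"
  shows "p b = 0"
  using assms(1,2,4,5)
proof (induction n arbitrary: p m b)
  case 0
  have "forward_diff k p b' = 0" for k b' using deg_le_forward_diff[OF 0(1), of k] by simp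
  then have "p b = p (\<lambda>j. 0)" using const_if_forward_diff_0[OF 0(1) assms(3)] 0(4) by blast
  also have "\<dots> = 0" using 0(3)[of "\<lambda>j. 0"] by simp
  finally show ?case .
next
  case (Suc n)
  obtain m' where m': "m = Suc m'" "n \<le> m'" using Suc.prems(2) by (cases m) auto
  have "forward_diff k p b' = 0" if k: "k \<in> A" and b': "\<And>j. j \<notin> A \<Longrightarrow> b' j = 0" for k b'
  proof (rule Suc.IH[OF _ m'(2) _ b'])
    show "deg_le n (forward_diff k p)" using deg_le_forward_diff[OF Suc.prems(1), of k] by simp
  next
    fix c :: "nat \<Rightarrow> nat" assume c: "\<And>j. j \<notin> A \<Longrightarrow> c j = 0" "(\<Sum>j\<in>A. c j) \<le> m'"
    have "(\<Sum>j\<in>A. (c(k := Suc (c k))) j) = Suc (c k) + (\<Sum>j\<in>A - {k}. c j)"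
      using k assms(3) by (subst sum.remove[of A k]) (auto intro!: sum.cong)
    also have "\<dots> = Suc (\<Sum>j\<in>A. c j)"
      using k assms(3) by (subst sum.remove[of A k c]) auto
    finally have "p (\<lambda>j. of_nat ((c(k := Suc (c k))) j)) = 0"
      using c k m' by (intro Suc.prems(3)) auto
    moreover have "(\<lambda>j. of_nat ((c(k := Suc (c k))) j)) = (\<lambda>j. of_nat (c j) :: complex)(k := of_nat (c k) + 1)"
      by (auto simp: fun_eq_iff)
    moreover have "p (\<lambda>j. of_nat (c j)) = 0" using c m' by (intro Suc.prems(3)) auto
    ultimately show "forward_diff k p (\<lambda>j. of_nat (c j)) = 0" by (simp add: forward_diff_def)
  qed
  then have "p b = p (\<lambda>j. 0)" by (rule const_if_forward_diff_0[OF Suc.prems(1) assms(3) _ Suc.prems(4)])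
  also have "\<dots> = 0" using Suc.prems(3)[of "\<lambda>j. 0"] by simp
  finally show ?case .
qed

section \<open>Determinants of linear combinations\<close>

lemma mat_scale_nth [simp]: "mat_scale c A $ i $ j = c * A $ i $ j"
  by (simp add: mat_scale_def map_matrix_def)

lemma det_mat_scale: "det (mat_scale c A) = c ^ CARD('n) * det A"
  for A :: "'a::comm_ring_1 ^ 'n::finite ^ 'n"
  by (simp add: det_def prod.distrib sum_distrib_left mult_ac)

lemma sum_list_replicate_mat:
  "sum_list (replicate k A) = mat_scale (of_nat k) A" for A :: "'a::comm_semiring_1 ^ 'n ^ 'm"
  by (induction k) (simp_all add: vec_eq_iff distrib_right)

lemma sum_with_multiplicities:
  fixes M :: "'b \<Rightarrow> 'a::comm_semiring_1 ^ 'n ^ 'm" and s :: nat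
  obtains xs where "length xs = (\<Sum>j=1..s. c j)"
    "sum_list (map M xs) = (\<Sum>j=1..s. mat_scale (of_nat (c j)) (M (\<alpha> j)))"
proof -
  have "\<exists>xs. length xs = (\<Sum>j=1..s. c j) \<and>
    sum_list (map M xs) = (\<Sum>j=1..s. mat_scale (of_nat (c j)) (M (\<alpha> j)))"
  proof (induction s)
    case (Suc s)
    then obtain xs where "length xs = (\<Sum>j=1..s. c j)"
      "sum_list (map M xs) = (\<Sum>j=1..s. mat_scale (of_nat (c j)) (M (\<alpha> j)))" by blast
    then show ?case
      by (intro exI[of _ "xs @ replicate (c (Suc s)) (\<alpha> (Suc s))"])
         (simp add: sum_list_replicate_mat)
  qed simp
  then show ?thesis using that by blast
qed

text \<open>
  The determinant of \<open>m A\<^sub>0 + \<Sum>\<^sub>j b\<^sub>j (A\<^sub>j - A\<^sub>0)\<close> has degree at most \<open>n \<le> m\<close> in \<open>b\<close>, and at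
  the natural points of the simplex \<open>\<Sum>\<^sub>j b\<^sub>j \<le> m\<close> it is the determinant of a sum of \<open>m\<close> of the
  matrices.
\<close>

lemma det_combination_sum_m:
  fixes M :: "'b \<Rightarrow> complex ^ 'n::finite ^ 'n" and m s :: nat
  assumes "CARD('n) \<le> m" and \<mu>: "\<And>\<alpha> :: nat \<Rightarrow> 'b. det (\<Sum>i=1..m. M (\<alpha> i)) = \<mu>"
    and b: "(\<Sum>j=1..s. b j) = of_nat m"
  shows "det (\<Sum>j=1..s. mat_scale (b j) (M (\<alpha> j))) = \<mu>"
proof -
  define A0 where "A0 = M (\<alpha> 0)"
  define N where "N b = (\<chi> i l. of_nat m * A0 $ i $ l + (\<Sum>j=1..s. b j * (M (\<alpha> j) $ i $ l - A0 $ i $ l)))"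
    for b :: "nat \<Rightarrow> complex"
  define p where "p b = det (N b) - \<mu>" for b
  have "deg_le (0 + CARD('n)) (\<lambda>b. (\<Sum>\<pi> | \<pi> permutes UNIV. of_int (sign \<pi>) * (\<Prod>i\<in>UNIV.
     of_nat m * A0 $ i $ \<pi> i + (\<Sum>j=1..s. b j * (M (\<alpha> j) $ i $ \<pi> i - A0 $ i $ \<pi> i)))) + (- \<mu>))"
    by (simp only: add_0) (intro deg_le.add deg_le.const deg_le_sum deg_le_cmult deg_le_affine_prod finite)
  then have deg: "deg_le CARD('n) p" by (simp add: p_def[abs_def] N_def det_def)
  have comb: "N b = (\<Sum>j=1..s. mat_scale (b j) (M (\<alpha> j))) + mat_scale (of_nat m - (\<Sum>j=1..s. b j)) A0" for b
    by (simp add: N_def vec_eq_iff sum_component algebra_simps sum_subtractf sum_distrib_left sum_distrib_right)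
  have "p (\<lambda>j. if j \<in> {1..s} then b j else 0) = 0"
  proof (rule deg_le_eq_0_if_zero_on_simplex[OF deg assms(1), of "{1..s}"])
    fix c :: "nat \<Rightarrow> nat" assume c: "\<And>j. j \<notin> {1..s} \<Longrightarrow> c j = 0" "(\<Sum>j=1..s. c j) \<le> m"
    obtain xs where xs: "length xs = (\<Sum>j=1..s. c j)"
      "sum_list (map M xs) = (\<Sum>j=1..s. mat_scale (of_nat (c j)) (M (\<alpha> j)))"
      by (rule sum_with_multiplicities)
    define ys where "ys = xs @ replicate (m - length xs) (\<alpha> 0)"
    have len: "length ys = m" using xs(1) c(2) by (simp add: ys_def)
    have "(\<Sum>i=1..m. M (ys ! (i - 1))) = (\<Sum>i<m. M (ys ! i))"
      by (rule sum.reindex_bij_witness[of _ Suc "\<lambda>i. i - 1"]) auto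
    also have "\<dots> = sum_list (map M ys)"
      by (simp add: sum_list_sum_nth len atLeast0LessThan)
    also have "\<dots> = N (\<lambda>j. of_nat (c j))"
      using c(2) unfolding comb by (simp add: ys_def xs sum_list_replicate_mat A0_def of_nat_diff)
    finally show "p (\<lambda>j. of_nat (c j)) = 0" using \<mu>[of "\<lambda>i. ys ! (i - 1)"] by (simp add: p_def)
  qed auto
  moreover have "N (\<lambda>j. if j \<in> {1..s} then b j else 0) = N b"
    by (simp add: N_def vec_eq_iff)
  moreover have "N b = (\<Sum>j=1..s. mat_scale (b j) (M (\<alpha> j)))"
    unfolding comb b by (simp add: vec_eq_iff)
  ultimately show ?thesis by (simp add: p_def)
qed

lemma det_line_poly:
  fixes X A :: "complex ^ 'n::finite ^ 'n"
  obtains P where "\<And>t. det (X + mat_scale t A) = poly P t"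
proof
  show "det (X + mat_scale t A) = poly (det (\<chi> i j. [:X $ i $ j, A $ i $ j:])) t" for t
    by (simp add: det_def poly_sum poly_prod)
qed

text \<open>
  If the weights have sum \<open>\<sigma> \<noteq> 0\<close>, scale them to have sum \<open>m\<close> and use homogeneity. The general case
  follows by adding a further matrix with weight \<open>t\<close>: both sides are polynomials in \<open>t\<close> that agree
  unless \<open>\<sigma> + t = 0\<close>.
\<close>

lemma det_combination:
  fixes M :: "'b \<Rightarrow> complex ^ 'n::finite ^ 'n" and m s :: nat
  assumes m: "CARD('n) \<le> m" and \<mu>: "\<And>\<alpha> :: nat \<Rightarrow> 'b. det (\<Sum>i=1..m. M (\<alpha> i)) = \<mu>"
  shows "det (\<Sum>j=1..s. mat_scale (b j) (M (\<alpha> j))) = (1 / of_nat m * (\<Sum>j=1..s. b j)) ^ CARD('n) * \<mu>"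
proof -
  have m0: "of_nat m \<noteq> (0::complex)"
    using m zero_less_card_finite[where 'a = 'n] by (metis not_less of_nat_eq_0_iff)
  have nonzero: "det (\<Sum>j=1..s. mat_scale (b j) (M (\<alpha> j))) = (1 / of_nat m * (\<Sum>j=1..s. b j)) ^ CARD('n) * \<mu>"
    if "(\<Sum>j=1..s. b j) \<noteq> 0" for s :: nat and b \<alpha>
  proof -
    define \<sigma> where "\<sigma> = (\<Sum>j=1..s. b j)"
    define X where "X = (\<Sum>j=1..s. mat_scale (b j) (M (\<alpha> j)))"
    have "(\<Sum>j=1..s. of_nat m / \<sigma> * b j) = of_nat m / \<sigma> * \<sigma>"
      unfolding \<sigma>_def by (simp only: sum_distrib_left)
    also have "\<dots> = of_nat m" using that unfolding \<sigma>_def by simp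
    finally have "(\<Sum>j=1..s. of_nat m / \<sigma> * b j) = of_nat m" .
    then have "det (\<Sum>j=1..s. mat_scale (of_nat m / \<sigma> * b j) (M (\<alpha> j))) = \<mu>"
      by (rule det_combination_sum_m[OF m \<mu>])
    moreover have "(\<Sum>j=1..s. mat_scale (of_nat m / \<sigma> * b j) (M (\<alpha> j))) = mat_scale (of_nat m / \<sigma>) X"
      by (simp add: X_def vec_eq_iff sum_component sum_distrib_left mult.assoc)
    ultimately have "(of_nat m / \<sigma>) ^ CARD('n) * det X = \<mu>" by (simp add: det_mat_scale)
    then have "det X = (\<sigma> / of_nat m) ^ CARD('n) * \<mu>"
      using m0 that by (auto simp: \<sigma>_def power_divide)
    then show ?thesis by (simp add: X_def \<sigma>_def)
  qed
  define \<sigma> where "\<sigma> = (\<Sum>j=1..s. b j)"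
  obtain P where P: "\<And>t. det ((\<Sum>j=1..s. mat_scale (b j) (M (\<alpha> j))) + mat_scale t (M (\<alpha> 1))) = poly P t"
    using det_line_poly by blast
  define R where "R = smult \<mu> ([:\<sigma> / of_nat m, 1 / of_nat m:] ^ CARD('n))"
  have "P = R"
  proof (rule poly_eqI_off_roots[of "[:\<sigma>, 1:]"])
    fix t assume "poly [:\<sigma>, 1:] t \<noteq> 0"
    then have "(\<Sum>j=1..Suc s. (if j = Suc s then t else b j)) \<noteq> 0" by (simp add: \<sigma>_def)
    from nonzero[OF this, of "\<lambda>j. if j = Suc s then \<alpha> 1 else \<alpha> j"]
    have "poly P t = (1 / of_nat m * (\<sigma> + t)) ^ CARD('n) * \<mu>"
      by (simp add: P[symmetric] \<sigma>_def)
    then show "poly P t = poly R t"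
      by (simp add: R_def poly_power add_divide_distrib mult.commute)
  qed simp
  then have "poly P 0 = (1 / of_nat m * \<sigma>) ^ CARD('n) * \<mu>" by (simp add: R_def poly_power mult.commute)
  moreover have "mat_scale 0 (M (\<alpha> 1)) = 0" by (simp add: vec_eq_iff)
  ultimately show ?thesis using P[of 0] by (simp add: \<sigma>_def)
qed

section \<open>Polynomial maps and sums of their Jacobians\<close>

lemma poly_map_nth: "poly_map F x $ i = mpoly_eval (F $ i) x"
  by (simp add: poly_map_def)

lemma Jac_at_nth: "Jac_at F x $ i $ j = mpoly_eval (mpoly_deriv j (F $ i)) x"
  by (simp add: Jac_at_def Jac_def map_matrix_def)

lemma has_derivative_poly_map:
  fixes F :: "('n::finite, complex) mpoly ^ 'n"
  shows "(poly_map F has_derivative (\<lambda>h. Jac_at F x *v h)) (at x)"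
proof -
  have bl: "bounded_linear (\<lambda>c. axis i c :: complex ^ 'n)" for i
  proof -
    have "linear (\<lambda>c. axis i c :: complex ^ 'n)"
      by (rule linearI) (auto simp: vec_eq_iff axis_def)
    then show ?thesis by (simp add: linear_conv_bounded_linear)
  qed
  have expand: "v = (\<Sum>i\<in>UNIV. axis i (v $ i))" for v :: "complex ^ 'n"
    by (simp add: vec_eq_iff sum_component axis_def)
  have "((\<lambda>x. \<Sum>i\<in>UNIV. axis i (mpoly_eval (F $ i) x)) has_derivative
     (\<lambda>h. \<Sum>i\<in>UNIV. axis i (\<Sum>j\<in>UNIV. mpoly_eval (mpoly_deriv j (F $ i)) x * h $ j))) (at x)"
    by (intro has_derivative_sum bounded_linear.has_derivative[OF bl] has_derivative_mpoly_eval)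
  moreover have "(\<Sum>i\<in>UNIV. axis i (mpoly_eval (F $ i) x)) = poly_map F x" for x
    by (subst expand[of "poly_map F x"]) (simp add: poly_map_nth)
  moreover have "(\<Sum>i\<in>UNIV. axis i (\<Sum>j\<in>UNIV. mpoly_eval (mpoly_deriv j (F $ i)) x * h $ j)) = Jac_at F x *v h" for h
    by (subst expand[of "Jac_at F x *v h"]) (simp add: matrix_vector_mult_def Jac_at_nth)
  ultimately show ?thesis by simp
qed

lemma poly_has_derivative_imp_pderiv:
  fixes P :: "complex poly"
  assumes "\<And>t. \<phi> t = poly P t" "(\<phi> has_field_derivative d) (at t)"
  shows "poly (pderiv P) t = d"
proof -
  have "\<phi> = poly P" using assms(1) by (simp add: fun_eq_iff)
  then show ?thesis using assms(2) poly_DERIV[of P t] DERIV_unique by blast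
qed

text \<open>
  By exact quadrature along the segment from \<open>y\<close> to \<open>x\<close>, the difference of the values at \<open>x\<close> and
  \<open>y\<close> is \<open>N *v (x - y)\<close>, where \<open>N\<close> is a linear combination of Jacobians with weights of sum 1.
\<close>

lemma poly_map_inj_if_combinations_nonsingular:
  fixes F :: "('n::finite, complex) mpoly ^ 'n"
  assumes nonsing: "\<And>(s::nat) (\<alpha> :: nat \<Rightarrow> complex ^ 'n) b.
      (\<Sum>j=1..s. b j) = 1 \<Longrightarrow> det (\<Sum>j=1..s. mat_scale (b j) (Jac_at F (\<alpha> j))) \<noteq> 0"
  shows "inj (poly_map F)"
proof (rule injI)
  fix x y assume eq: "poly_map F x = poly_map F y"
  define h where "h = x - y"
  have "\<exists>P. \<forall>t. mpoly_eval (F $ i) (y + t *s h) = poly P t" for i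
    using polyfun_line[OF polyfun_mpoly_eval] by metis
  then obtain P where P: "\<And>i t. mpoly_eval (F $ i) (y + t *s h) = poly (P i) t" by metis
  have dP: "poly (pderiv (P i)) t = (\<Sum>j\<in>UNIV. Jac_at F (y + t *s h) $ i $ j * h $ j)" for i t
  proof (rule poly_has_derivative_imp_pderiv[of "\<lambda>t. mpoly_eval (F $ i) (y + t *s h)"])
    have "((\<lambda>t. mpoly_eval (F $ i) (y + t *s h)) has_derivative
      (\<lambda>t'. \<Sum>j\<in>UNIV. mpoly_eval (mpoly_deriv j (F $ i)) (y + t *s h) * (t' *s h) $ j)) (at t)"
      by (rule has_derivative_compose[OF has_derivative_line has_derivative_mpoly_eval])
    then show "((\<lambda>t. mpoly_eval (F $ i) (y + t *s h)) has_field_derivative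
       (\<Sum>j\<in>UNIV. Jac_at F (y + t *s h) $ i $ j * h $ j)) (at t)"
      unfolding has_field_derivative_def
      by (elim has_derivative_eq_rhs) (simp add: fun_eq_iff Jac_at_nth sum_distrib_left sum_distrib_right mult_ac)
  qed (rule P)
  define d where "d = Max (range (\<lambda>i. degree (P i)))"
  have deg: "degree (P i) \<le> Suc d" for i
  proof -
    have "degree (P i) \<le> d" unfolding d_def by (rule Max_ge) auto
    then show ?thesis by simp
  qed
  obtain w :: "nat \<Rightarrow> complex" where w: "\<And>p. degree p \<le> Suc d \<Longrightarrow>
      (\<Sum>k\<le>d. w k * poly (pderiv p) (of_nat k)) = poly p 1 - poly p 0"
    by (rule exact_quadrature[of d]) blast
  define N where "N = (\<Sum>j=1..Suc d. mat_scale (w (j - 1)) (Jac_at F (y + of_nat (j - 1) *s h)))"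
  have shift: "(\<Sum>j=1..Suc d. q (j - 1)) = (\<Sum>k\<le>d. q k)" for q :: "nat \<Rightarrow> complex"
    by (rule sum.reindex_bij_witness[of _ Suc "\<lambda>j. j - 1"]) auto
  have "(\<Sum>j=1..Suc d. w (j - 1)) = 1"
    unfolding shift using w[of "[:0, 1:]"] by (simp add: pderiv_pCons)
  then have "det N \<noteq> 0" unfolding N_def by (rule nonsing)
  moreover have "N *v h = 0"
  proof (rule vec_eq_iff[THEN iffD2], rule allI)
    fix i
    have "(N *v h) $ i = (\<Sum>l\<in>UNIV. \<Sum>j=1..Suc d. w (j - 1) * (Jac_at F (y + of_nat (j - 1) *s h) $ i $ l * h $ l))"
      by (simp add: N_def matrix_vector_mult_def sum_component sum_distrib_right mult.assoc del: sum.cl_ivl_Suc)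
    also have "\<dots> = (\<Sum>j=1..Suc d. w (j - 1) * poly (pderiv (P i)) (of_nat (j - 1)))"
      by (subst sum.swap) (simp add: dP sum_distrib_left del: sum.cl_ivl_Suc)
    also have "\<dots> = (\<Sum>k\<le>d. w k * poly (pderiv (P i)) (of_nat k))"
      by (rule shift[of "\<lambda>k. w k * poly (pderiv (P i)) (of_nat k)"])
    also have "\<dots> = poly (P i) 1 - poly (P i) 0" by (rule w[OF deg])
    also have "\<dots> = 0"
    proof -
      have ends: "y + 1 *s h = x" "y + 0 *s h = y" by (simp_all add: h_def vec_eq_iff)
      have "poly (P i) 1 = poly_map F x $ i" "poly (P i) 0 = poly_map F y $ i"
        unfolding P[symmetric] ends poly_map_nth by (rule refl)+
      then show ?thesis using eq by simp
    qed
    finally show "(N *v h) $ i = 0 $ i" by simp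
  qed
  ultimately have "h = 0"
    using invertible_det_nz[of N] by (metis matrix_left_invertible_ker invertible_def)
  then show "x = y" by (simp add: h_def)
qed

lemma invertible_poly_map_if_inj:
  fixes F :: "('n::finite, complex) mpoly ^ 'n"
  assumes "inj (poly_map F)" "\<And>x. det (Jac_at F x) = \<kappa>" "\<kappa> \<noteq> 0"
  shows "invertible_poly_map F"
proof -
  interpret unimodular_injection "poly_map F" "Jac_at F" \<kappa>
    by unfold_locales
       (use assms in \<open>simp_all add: poly_map_nth Jac_at_nth polyfun_mpoly_eval has_derivative_poly_map\<close>)
  have "\<exists>p. \<forall>y. g y $ i = mpoly_eval p y" for i
    using polyfun_imp_mpoly[OF polyfun_g[of i]] by metis
  then obtain p where p: "\<And>i y. g y $ i = mpoly_eval (p i) y" by metis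
  have "poly_map (\<chi> i. p i) = g" by (simp add: fun_eq_iff vec_eq_iff poly_map_nth p)
  moreover have "g \<circ> poly_map F = id" by (simp add: fun_eq_iff)
  moreover have "poly_map F \<circ> g = id" using f_g surj_f by (simp add: fun_eq_iff)
  ultimately show ?thesis unfolding invertible_poly_map_def by metis
qed

theorem theorem3p5:
  fixes F :: "('n::finite, complex) mpoly ^ 'n"
    and m :: nat
    and \<mu> :: complex
  assumes "m \<ge> CARD('n)"
    and "\<And>\<alpha> :: nat \<Rightarrow> complex ^ 'n. det (\<Sum>i=1..m. Jac_at F (\<alpha> i)) = \<mu>"
  shows "mpoly_const \<mu> = det (mat_scale (of_nat m) (Jac F))
       \<and> det (mat_scale (of_nat m) (Jac F)) = of_nat m ^ CARD('n) * det (Jac F)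
       \<and> (\<forall>(s::nat) (\<alpha> :: nat \<Rightarrow> complex ^ 'n) (b :: nat \<Rightarrow> complex).
            det (\<Sum>i=1..s. mat_scale (b i) (Jac_at F (\<alpha> i)))
              = (1 / of_nat m * (\<Sum>i=1..s. b i)) ^ CARD('n) * \<mu>
          \<and> mpoly_const ((1 / of_nat m * (\<Sum>i=1..s. b i)) ^ CARD('n) * \<mu>)
              = mpoly_const ((\<Sum>i=1..s. b i) ^ CARD('n)) * det (Jac F))
       \<and> (det (Jac F) \<noteq> 0 \<longrightarrow> invertible_poly_map F)"
proof -
  define \<kappa> where "\<kappa> = (1 / of_nat m) ^ CARD('n) * \<mu>"
  have m0: "of_nat m \<noteq> (0::complex)"
    using assms(1) zero_less_card_finite[where 'a = 'n] by (metis not_less of_nat_eq_0_iff)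
  have comb: "det (\<Sum>i=1..s. mat_scale (b i) (Jac_at F (\<alpha> i))) = (1 / of_nat m * (\<Sum>i=1..s. b i)) ^ CARD('n) * \<mu>"
    for s :: nat and \<alpha> :: "nat \<Rightarrow> complex ^ 'n" and b
    by (rule det_combination[OF assms])
  have detJ: "det (Jac_at F x) = \<kappa>" for x
  proof -
    have "mat_scale 1 (Jac_at F x) = Jac_at F x" by (simp add: vec_eq_iff)
    then show ?thesis using comb[where s = 1 and b = "\<lambda>_. 1" and \<alpha> = "\<lambda>_. x"] by (simp add: \<kappa>_def)
  qed
  have eval: "mpoly_eval (det (Jac F)) x = \<kappa>" for x
    by (simp add: mpoly_eval_det detJ flip: Jac_at_def)
  have scale: "det (mat_scale (of_nat m) (Jac F)) = of_nat m ^ CARD('n) * det (Jac F)"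
    by (rule det_mat_scale)
  have pow: "mpoly_eval (of_nat m ^ k) x = (of_nat m ^ k :: complex)" for k and x :: "complex ^ 'n"
    by (induction k) (simp_all add: mpoly_eval_mult)
  have "mpoly_const \<mu> = det (mat_scale (of_nat m) (Jac F))"
    unfolding scale
    by (rule mpoly_eqI) (use m0 in \<open>simp add: mpoly_eval_mult eval pow \<kappa>_def power_divide\<close>)
  moreover have "mpoly_const ((1 / of_nat m * (\<Sum>i=1..s. b i)) ^ CARD('n) * \<mu>)
              = mpoly_const ((\<Sum>i=1..s. b i) ^ CARD('n)) * det (Jac F)" for s :: nat and b
    by (rule mpoly_eqI) (simp add: mpoly_eval_mult eval \<kappa>_def power_mult_distrib power_divide)
  moreover have "invertible_poly_map F" if "det (Jac F) \<noteq> 0"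
  proof -
    have "\<kappa> \<noteq> 0"
    proof
      assume "\<kappa> = 0"
      then have "det (Jac F) = 0" by (intro mpoly_eq_0I) (simp add: eval)
      then show False using that by simp
    qed
    moreover have "inj (poly_map F)"
    proof (rule poly_map_inj_if_combinations_nonsingular)
      fix s :: nat and \<alpha> :: "nat \<Rightarrow> complex ^ 'n" and b :: "nat \<Rightarrow> complex"
      assume one: "(\<Sum>j=1..s. b j) = 1"
      have "det (\<Sum>j=1..s. mat_scale (b j) (Jac_at F (\<alpha> j))) = \<kappa>"
        unfolding comb one \<kappa>_def by simp
      then show "det (\<Sum>j=1..s. mat_scale (b j) (Jac_at F (\<alpha> j))) \<noteq> 0" using \<open>\<kappa> \<noteq> 0\<close> by simp
    qed
    ultimately show ?thesis using detJ by (intro invertible_poly_map_if_inj)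
  qed
  ultimately show ?thesis using scale comb by blast
qed

end
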